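(* (A) For any finite pseudo-metric space $\mathcal M=(M,\rho)$, there exists a minimal filling which is a binary tree. If the space $\mathcal M$ is a metric one, then it has as well a minimal filling which is a non-degenerate tree. Conversely, if for $\mathcal M$ there exists a non-degenerate minimal filling, then $\mathcal M$ is a metric space. (B) For any finite subset $M$ of a pseudo-metric space $\mathcal X=(X,d)$, there exists a shortest binary tree joining $M$. If the distances between different points from $M$ are non-zero, then there exists a shortest non-degenerate tree joining $M$. Conversely, if there exists a shortest non-degenerate tree joining $M$, then the distances between different points from $M$ are non-zero.
   Context: In a pseudo-metric space the distance between distinct points may be $0$. All graphs are finite. Fillings. A graph $G=(V,E)$ joins a finite set $M$ if $G$ is connected and $M\subset V$; then $M$ is the boundary $\partial G$ of $G$. For a weight function $\omega:E\to[0,\infty)$, $d_\omega(u,v)$ is the least weight (sum of $\omega$ over edges) of a path in $G$ joining $u$ and $v$, and $\omega(G)=\sum_{e\in E}\omega(e)$. The weighted graph $(G,\omega)$ is a filling of $(M,\rho)$ if $G$ joins $M$ and $\rho(p,q)\le d_\omega(p,q)$ for all $p,q\in M$. The number $\mathrm{mf}(\mathcal M)$ is the infimum of $\omega(G)$ over all fillings $(G,\omega)$ of $\mathcal M$ (over all graphs $G$), and a minimal filling is a filling with $\omega(G)=\mathrm{mf}(\mathcal M)$. An edge of weight $0$ is degenerate; a weighted graph without degenerate edges is non-degenerate. Networks. A network of type $G$ in $\mathcal X=(X,d)$, where $G=(V,E)$ is a connected graph with a chosen set $\partial G\subset V$ of boundary vertices, is a map $\Gamma:V\to X$ (parameterized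 by $G$); its length is $d(\Gamma)=\sum_{vw\in E}d(\Gamma(v),\Gamma(w))$. It joins $M\subset X$ if $M\subset\Gamma(V)$; the boundary $\Gamma|_{\partial G}$ of a network joining $M$ is taken to have image $M$. $\mathrm{smt}(M)$ is the infimum of $d(\Gamma)$ over all networks joining $M$, and a shortest network joining $M$ is a network joining $M$ of length $\mathrm{smt}(M)$. An edge $vw$ of a network is degenerate if $d(\Gamma(v),\Gamma(w))=0$; a network without degenerate edges is non-degenerate. A shortest binary tree (respectively, shortest non-degenerate tree) joining $M$ is a shortest network joining $M$ which is parameterized by a binary tree (respectively, is parameterized by a tree and is non-degenerate). A binary tree is a tree all of whose vertices have degree $1$ or $3$ and whose boundary is exactly the set of its vertices of degree $1$.
   Formalization: The two existence claims of (B) assume that some shortest network joining M exists (the infimum smt(M) need not be attained); the binary-tree claim of (A) is for |M| ≥ 2 and that of (B) for non-empty M, since a binary tree has at least two vertices of degree 1. *)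

theory Defs
  imports "HOL-Analysis.Abstract_Metric_Spaces"
begin

section \<open>Pseudo-metric spaces\<close>

text \<open>The axioms of the library locale \<^locale>\<open>Metric_space\<close> without the requirement that distinct
  points have non-zero distance. As there, non-negativity and symmetry are not relativised to the
  carrier; the values of the distance outside the carrier never matter.\<close>

locale Pseudometric_space =
  fixes M :: "'a set" and d :: "'a \<Rightarrow> 'a \<Rightarrow> real"
  assumes nonneg: "\<And>x y. 0 \<le> d x y"
    and commute: "\<And>x y. d x y = d y x"
    and refl: "\<And>x. x \<in> M \<Longrightarrow> d x x = 0"
    and triangle: "\<And>x y z. \<lbrakk>x \<in> M; y \<in> M; z \<in> M\<rbrakk> \<Longrightarrow> d x z \<le> d x y + d y z"

lemma Metric_space_iff_Pseudometric_space:
  "Metric_space M d \<longleftrightarrow>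
     Pseudometric_space M d \<and> (\<forall>x\<in>M. \<forall>y\<in>M. x \<noteq> y \<longrightarrow> d x y \<noteq> 0)"
proof
  assume "Metric_space M d"
  then interpret Metric_space M d .
  show "Pseudometric_space M d \<and> (\<forall>x\<in>M. \<forall>y\<in>M. x \<noteq> y \<longrightarrow> d x y \<noteq> 0)"
    by (simp add: Pseudometric_space_def commute triangle)
next
  assume *: "Pseudometric_space M d \<and> (\<forall>x\<in>M. \<forall>y\<in>M. x \<noteq> y \<longrightarrow> d x y \<noteq> 0)"
  then interpret Pseudometric_space M d by simp
  show "Metric_space M d"
    by unfold_locales (use * in \<open>auto intro: nonneg commute refl triangle\<close>)
qed


section \<open>Finite graphs\<close>

text \<open>Graphs are simple and undirected; an edge is the two-element set of its end points.\<close>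

definition fin_graph :: "'v set \<Rightarrow> 'v set set \<Rightarrow> bool" where
  "fin_graph V E \<longleftrightarrow> finite V \<and> (\<forall>e\<in>E. \<exists>u\<in>V. \<exists>v\<in>V. u \<noteq> v \<and> e = {u, v})"

definition graph_paths :: "'v set \<Rightarrow> 'v set set \<Rightarrow> 'v \<Rightarrow> 'v \<Rightarrow> 'v list set" where
  "graph_paths V E u v =
     {p. p \<noteq> [] \<and> set p \<subseteq> V \<and> distinct p \<and> successively (\<lambda>x y. {x, y} \<in> E) p \<and>
         hd p = u \<and> last p = v}"

definition graph_connected :: "'v set \<Rightarrow> 'v set set \<Rightarrow> bool" where
  "graph_connected V E \<longleftrightarrow> V \<noteq> {} \<and> (\<forall>u\<in>V. \<forall>v\<in>V. graph_paths V E u v \<noteq> {})"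

definition graph_cycle :: "'v set \<Rightarrow> 'v set set \<Rightarrow> 'v list \<Rightarrow> bool" where
  "graph_cycle V E p \<longleftrightarrow>
     3 \<le> length p \<and> set p \<subseteq> V \<and> distinct p \<and> successively (\<lambda>x y. {x, y} \<in> E) p \<and>
     {last p, hd p} \<in> E"

definition graph_tree :: "'v set \<Rightarrow> 'v set set \<Rightarrow> bool" where
  "graph_tree V E \<longleftrightarrow> fin_graph V E \<and> graph_connected V E \<and> (\<nexists>p. graph_cycle V E p)"

definition vertex_degree :: "'v set set \<Rightarrow> 'v \<Rightarrow> nat" where
  "vertex_degree E v = card {e \<in> E. v \<in> e}"

text \<open>The third argument is the boundary of the graph.\<close>

definition binary_tree :: "'v set \<Rightarrow> 'v set set \<Rightarrow> 'v set \<Rightarrow> bool" where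
  "binary_tree V E B \<longleftrightarrow>
     graph_tree V E \<and> (\<forall>v\<in>V. vertex_degree E v = 1 \<or> vertex_degree E v = 3) \<and>
     B = {v \<in> V. vertex_degree E v = 1}"


section \<open>Weighted graphs and fillings\<close>

definition path_weight :: "('v set \<Rightarrow> real) \<Rightarrow> 'v list \<Rightarrow> real" where
  "path_weight \<omega> p = (\<Sum>(x, y)\<leftarrow>zip p (tl p). \<omega> {x, y})"

definition weight_dist ::
    "'v set \<Rightarrow> 'v set set \<Rightarrow> ('v set \<Rightarrow> real) \<Rightarrow> 'v \<Rightarrow> 'v \<Rightarrow> real" where
  "weight_dist V E \<omega> u v = Min (path_weight \<omega> ` graph_paths V E u v)"

lemma finite_graph_paths: "finite V \<Longrightarrow> finite (graph_paths V E u v)"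
  by (rule finite_subset[OF _ finite_subset_distinct[of V]]) (auto simp: graph_paths_def)

text \<open>A graph joining \<open>M :: 'a set\<close> has \<open>M\<close> among its vertices, together with arbitrarily many
  further ones. All finite graphs containing \<open>M\<close> are represented, up to isomorphism over \<open>M\<close>, by
  graphs with vertices in \<open>'a + nat\<close> in which \<open>p \<in> M\<close> is identified with \<open>Inl p\<close>.\<close>

definition graph_joins :: "('a + nat) set \<Rightarrow> ('a + nat) set set \<Rightarrow> 'a set \<Rightarrow> bool" where
  "graph_joins V E M \<longleftrightarrow> fin_graph V E \<and> graph_connected V E \<and> Inl ` M \<subseteq> V"

definition filling ::
    "'a set \<Rightarrow> ('a \<Rightarrow> 'a \<Rightarrow> real) \<Rightarrow>
     ('a + nat) set \<Rightarrow> ('a + nat) set set \<Rightarrow> (('a + nat) set \<Rightarrow> real) \<Rightarrow> bool" where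
  "filling M \<rho> V E \<omega> \<longleftrightarrow>
     graph_joins V E M \<and> (\<forall>e\<in>E. 0 \<le> \<omega> e) \<and>
     (\<forall>p\<in>M. \<forall>q\<in>M. \<rho> p q \<le> weight_dist V E \<omega> (Inl p) (Inl q))"

definition mf :: "'a set \<Rightarrow> ('a \<Rightarrow> 'a \<Rightarrow> real) \<Rightarrow> real" where
  "mf M \<rho> = Inf {sum \<omega> E |V E \<omega>. filling M \<rho> V E \<omega>}"

definition minimal_filling ::
    "'a set \<Rightarrow> ('a \<Rightarrow> 'a \<Rightarrow> real) \<Rightarrow>
     ('a + nat) set \<Rightarrow> ('a + nat) set set \<Rightarrow> (('a + nat) set \<Rightarrow> real) \<Rightarrow> bool" where
  "minimal_filling M \<rho> V E \<omega> \<longleftrightarrow> filling M \<rho> V E \<omega> \<and> sum \<omega> E = mf M \<rho>"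

definition nondegenerate_weight :: "'v set set \<Rightarrow> ('v set \<Rightarrow> real) \<Rightarrow> bool" where
  "nondegenerate_weight E \<omega> \<longleftrightarrow> (\<forall>e\<in>E. \<omega> e \<noteq> 0)"


section \<open>Networks\<close>

definition edge_length :: "('x \<Rightarrow> 'x \<Rightarrow> real) \<Rightarrow> ('v \<Rightarrow> 'x) \<Rightarrow> 'v set \<Rightarrow> real" where
  "edge_length d \<Gamma> e = (THE r. \<exists>v w. e = {v, w} \<and> r = d (\<Gamma> v) (\<Gamma> w))"

lemma edge_length_doubleton:
  assumes "\<And>x y. d x y = d y x"
  shows "edge_length d \<Gamma> {v, w} = d (\<Gamma> v) (\<Gamma> w)"
  unfolding edge_length_def
proof (rule the_equality)
  show "\<exists>v' w'. {v, w} = {v', w'} \<and> d (\<Gamma> v) (\<Gamma> w) = d (\<Gamma> v') (\<Gamma> w')"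
    by blast
next
  fix r assume "\<exists>v' w'. {v, w} = {v', w'} \<and> r = d (\<Gamma> v') (\<Gamma> w')"
  then show "r = d (\<Gamma> v) (\<Gamma> w)"
    using assms[of "\<Gamma> v" "\<Gamma> w"] by (auto simp: doubleton_eq_iff)
qed

definition network_length ::
    "('x \<Rightarrow> 'x \<Rightarrow> real) \<Rightarrow> 'v set set \<Rightarrow> ('v \<Rightarrow> 'x) \<Rightarrow> real" where
  "network_length d E \<Gamma> = (\<Sum>e\<in>E. edge_length d \<Gamma> e)"

text \<open>Only the isomorphism type of a parameterizing graph matters, so its vertices are taken to be
  natural numbers. \<open>B\<close> is its chosen boundary.\<close>

definition network ::
    "'x set \<Rightarrow> nat set \<Rightarrow> nat set set \<Rightarrow> nat set \<Rightarrow> (nat \<Rightarrow> 'x) \<Rightarrow> bool" where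
  "network X V E B \<Gamma> \<longleftrightarrow>
     fin_graph V E \<and> graph_connected V E \<and> B \<subseteq> V \<and> \<Gamma> ` V \<subseteq> X"

definition network_joins ::
    "'x set \<Rightarrow> 'x set \<Rightarrow> nat set \<Rightarrow> nat set set \<Rightarrow> nat set \<Rightarrow> (nat \<Rightarrow> 'x) \<Rightarrow> bool" where
  "network_joins X M V E B \<Gamma> \<longleftrightarrow> network X V E B \<Gamma> \<and> M \<subseteq> \<Gamma> ` V \<and> \<Gamma> ` B = M"

definition smt :: "'x set \<Rightarrow> ('x \<Rightarrow> 'x \<Rightarrow> real) \<Rightarrow> 'x set \<Rightarrow> real" where
  "smt X d M = Inf {network_length d E \<Gamma> |V E B \<Gamma>. network_joins X M V E B \<Gamma>}"

definition shortest_network ::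
    "'x set \<Rightarrow> ('x \<Rightarrow> 'x \<Rightarrow> real) \<Rightarrow> 'x set \<Rightarrow>
     nat set \<Rightarrow> nat set set \<Rightarrow> nat set \<Rightarrow> (nat \<Rightarrow> 'x) \<Rightarrow> bool" where
  "shortest_network X d M V E B \<Gamma> \<longleftrightarrow>
     network_joins X M V E B \<Gamma> \<and> network_length d E \<Gamma> = smt X d M"

definition nondegenerate_network ::
    "('x \<Rightarrow> 'x \<Rightarrow> real) \<Rightarrow> nat set set \<Rightarrow> (nat \<Rightarrow> 'x) \<Rightarrow> bool" where
  "nondegenerate_network d E \<Gamma> \<longleftrightarrow> (\<forall>e\<in>E. edge_length d \<Gamma> e \<noteq> 0)"

definition shortest_binary_tree ::
    "'x set \<Rightarrow> ('x \<Rightarrow> 'x \<Rightarrow> real) \<Rightarrow> 'x set \<Rightarrow>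
     nat set \<Rightarrow> nat set set \<Rightarrow> nat set \<Rightarrow> (nat \<Rightarrow> 'x) \<Rightarrow> bool" where
  "shortest_binary_tree X d M V E B \<Gamma> \<longleftrightarrow>
     shortest_network X d M V E B \<Gamma> \<and> binary_tree V E B"

definition shortest_nondegenerate_tree ::
    "'x set \<Rightarrow> ('x \<Rightarrow> 'x \<Rightarrow> real) \<Rightarrow> 'x set \<Rightarrow>
     nat set \<Rightarrow> nat set set \<Rightarrow> nat set \<Rightarrow> (nat \<Rightarrow> 'x) \<Rightarrow> bool" where
  "shortest_nondegenerate_tree X d M V E B \<Gamma> \<longleftrightarrow>
     shortest_network X d M V E B \<Gamma> \<and> graph_tree V E \<and> nondegenerate_network d E \<Gamma>"

end

theory Submission
  imports Defs "HOL-Analysis.Function_Topology"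
begin

text \<open>
  Both parts rest on the same two surgeries on a network in a pseudo-metric space. A filling
  \<open>(V, E, \<omega>)\<close> of \<open>(M, \<rho>)\<close> enters the picture through its path distance \<open>graph_dist\<close>, a
  pseudo-metric on \<open>V\<close>: the identity is a network of type \<open>(V, E)\<close> in this space and is no longer than
  \<open>\<omega>(G)\<close>. Conversely, a network in any pseudo-metric space whose distances between the images of the
  points of \<open>M\<close> dominate \<open>\<rho>\<close> is a filling, weighted by its edge lengths (\<open>filling_of_network\<close>).

  \<^emph>\<open>Binary trees\<close> (\<open>binary_tree_of_network\<close>). A network joining \<open>N\<close> with \<open>|N| \<ge> 2\<close> can be replaced,
  without increasing the length, by a binary tree with one leaf for each point of \<open>N\<close>. By induction
  on the number of vertices: a connected graph with chosen vertex \<open>s\<close> splits along an edge \<open>{s, t}\<close>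
  into two connected parts. If both parts contain points of \<open>N\<close>, the two rooted binary trees obtained
  for them are hung below a new root placed at the image of \<open>s\<close>; if only one does, its tree is kept.
  The triangle inequality bounds the length of the tree plus the distance from its root to the image
  of \<open>s\<close>. Finally, one point of \<open>N\<close> is planted above the root.

  \<^emph>\<open>Non-degenerate trees\<close> (\<open>nondegenerate_tree_of_network\<close>). Vertices whose images are at distance
  \<open>0\<close> are collapsed to one representative, chosen over \<open>N\<close> where possible; since distinct points of
  \<open>N\<close> have non-zero distance none of them is lost. A spanning tree of the resulting graph is
  non-degenerate.

  For networks the existence of a shortest one is given, and the surgeries yield the claim. For fillings
  the infimum is attained: only the finitely many binary trees with vertices in a fixed finite set
  matter, and on each of them the weights that give a filling of bounded total weight form a compact
  set (\<open>minimal_weight_on_graph\<close>).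

  For the converse statements, suppose that \<open>p \<noteq> q\<close> are boundary points at distance \<open>0\<close> in a
  non-degenerate optimum. Joining them by an edge of weight \<open>0\<close> costs nothing and makes some edge of
  positive weight redundant (\<open>exchange_edge\<close>, \<open>filling_add_null_edge\<close>), which contradicts
  optimality.
\<close>

section \<open>Reachability and trees\<close>

text \<open>The adjacency relation; connectedness is handled through its reflexive transitive closure.\<close>

definition adj :: "'v set set \<Rightarrow> ('v \<times> 'v) set" where
  "adj E = {(u, v). {u, v} \<in> E}"

lemma sym_reach: "(u, v) \<in> (adj E)\<^sup>* \<Longrightarrow> (v, u) \<in> (adj E)\<^sup>*"
proof -
  have "sym (adj E)"
    by (auto simp: sym_def adj_def insert_commute)
  then show "(u, v) \<in> (adj E)\<^sup>* \<Longrightarrow> (v, u) \<in> (adj E)\<^sup>*"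
    using sym_rtrancl symD by metis
qed

lemma adj_reach: "{u, v} \<in> E \<Longrightarrow> (u, v) \<in> (adj E)\<^sup>*"
  by (auto simp: adj_def)

text \<open>A map that sends edges to connected pairs sends connected pairs to connected pairs. It will be
  applied to collapsing maps, which send some edges to loops.\<close>

lemma reach_map:
  assumes "(u, v) \<in> (adj E)\<^sup>*"
    and "\<And>a b. {a, b} \<in> E \<Longrightarrow> (f a, f b) \<in> (adj E')\<^sup>*"
  shows "(f u, f v) \<in> (adj E')\<^sup>*"
  using assms(1)
proof (induction rule: rtrancl_induct)
  case (step y z)
  then show ?case
    using assms(2)[of y z] by (auto simp: adj_def)
qed simp

lemma reach_mono: "(u, v) \<in> (adj E)\<^sup>* \<Longrightarrow> E \<subseteq> E' \<Longrightarrow> (u, v) \<in> (adj E')\<^sup>*"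
  using reach_map[of u v E "\<lambda>x. x" E'] by (auto intro: adj_reach)

text \<open>Weighted walks: vertices may be repeated, so walks can be concatenated.\<close>

inductive walk :: "'v set set \<Rightarrow> ('v set \<Rightarrow> real) \<Rightarrow> 'v \<Rightarrow> 'v \<Rightarrow> real \<Rightarrow> bool"
  for E \<omega> where
  walk_refl: "walk E \<omega> u u 0"
| walk_step: "{u, v} \<in> E \<Longrightarrow> walk E \<omega> v z w \<Longrightarrow> walk E \<omega> u z (\<omega> {u, v} + w)"

lemma walk_trans: "walk E \<omega> u v w \<Longrightarrow> walk E \<omega> v z w' \<Longrightarrow> walk E \<omega> u z (w + w')"
  by (induction rule: walk.induct) (auto simp: add.assoc intro: walk.intros)

lemma walk_sym: "walk E \<omega> u v w \<Longrightarrow> walk E \<omega> v u w"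
proof (induction rule: walk.induct)
  case (walk_step u v z w)
  have "walk E \<omega> v u (\<omega> {u, v})"
    using walk.walk_step[of v u E \<omega> u 0] walk_step(1) by (simp add: walk_refl insert_commute)
  from walk_trans[OF walk_step(3) this] show ?case
    by (simp add: add.commute)
qed (rule walk_refl)

lemma walk_reach: "walk E \<omega> u v w \<Longrightarrow> (u, v) \<in> (adj E)\<^sup>*"
  by (induction rule: walk.induct) (auto simp: adj_def intro: converse_rtrancl_into_rtrancl)

lemma reach_walk:
  assumes "(u, v) \<in> (adj E)\<^sup>*"
  shows "\<exists>w. walk E \<omega> u v w"
  using assms
proof (induction rule: converse_rtrancl_induct)
  case (step y z)
  then obtain w where "walk E \<omega> z v w" by blast
  with step(1) have "walk E \<omega> y v (\<omega> {y, z} + w)"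
    by (intro walk_step) (auto simp: adj_def)
  then show ?case by blast
qed (auto intro: walk_refl)

lemma path_weight_simps [simp]:
  "path_weight \<omega> [x] = 0"
  "path_weight \<omega> (x # y # p) = \<omega> {x, y} + path_weight \<omega> (y # p)"
  by (simp_all add: path_weight_def)

lemma path_walk:
  "p \<noteq> [] \<Longrightarrow> successively (\<lambda>x y. {x, y} \<in> E) p \<Longrightarrow> walk E \<omega> (hd p) (last p) (path_weight \<omega> p)"
proof (induction p rule: induct_list012)
  case (3 x y p)
  then show ?case using walk_step[of x y E \<omega> "last (y # p)" "path_weight \<omega> (y # p)"] by simp
qed (auto intro: walk_refl)

lemma path_weight_suffix_le:
  assumes "successively (\<lambda>x y. {x, y} \<in> E) (p @ x # q)" "\<And>e. e \<in> E \<Longrightarrow> 0 \<le> \<omega> e"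
  shows "path_weight \<omega> (x # q) \<le> path_weight \<omega> (p @ x # q)"
  using assms(1)
proof (induction p)
  case (Cons a p)
  show ?case
  proof (cases p)
    case Nil
    then show ?thesis using Cons assms(2) by auto
  next
    case (Cons b p')
    then have "{a, b} \<in> E" "path_weight \<omega> (x # q) \<le> path_weight \<omega> (p @ x # q)"
      using Cons.IH Cons.prems by auto
    then show ?thesis
      using assms(2)[of "{a, b}"] Cons by simp
  qed
qed simp

lemma fin_graph_finite_edges: "fin_graph V E \<Longrightarrow> finite E"
  by (rule finite_subset[of _ "Pow V"]) (auto simp: fin_graph_def)

lemma fin_graph_edgeD: "fin_graph V E \<Longrightarrow> {u, v} \<in> E \<Longrightarrow> u \<in> V \<and> v \<in> V \<and> u \<noteq> v"
  by (fastforce simp: fin_graph_def doubleton_eq_iff)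

lemma fin_graph_edgeE:
  assumes "fin_graph V E" "e \<in> E"
  obtains u v where "e = {u, v}" "u \<in> V" "v \<in> V" "u \<noteq> v"
  using assms by (auto simp: fin_graph_def)

lemma fin_graph_mono: "fin_graph V E \<Longrightarrow> E' \<subseteq> E \<Longrightarrow> fin_graph V E'"
  by (auto simp: fin_graph_def)

text \<open>Cutting the loops out of a walk does not increase its weight.\<close>

lemma walk_to_path:
  assumes "walk E \<omega> u v w" "fin_graph V E" "v \<in> V" "\<And>e. e \<in> E \<Longrightarrow> 0 \<le> \<omega> e"
  shows "\<exists>p\<in>graph_paths V E u v. path_weight \<omega> p \<le> w"
  using assms(1,3)
proof (induction rule: walk.induct)
  case (walk_refl u)
  then show ?case by (intro bexI[of _ "[u]"]) (auto simp: graph_paths_def)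
next
  case (walk_step u v z w)
  then obtain p where p: "p \<in> graph_paths V E v z" "path_weight \<omega> p \<le> w" by blast
  have uv: "u \<in> V" "0 \<le> \<omega> {u, v}"
    using walk_step(1) assms(2,4) fin_graph_edgeD by metis+
  show ?case
  proof (cases "u \<in> set p")
    case True
    then obtain p1 p2 where eq: "p = p1 @ u # p2" by (auto dest: split_list)
    have "u # p2 \<in> graph_paths V E u z"
      using p(1) by (auto simp: graph_paths_def eq successively_append_iff)
    moreover have "path_weight \<omega> (u # p2) \<le> path_weight \<omega> p"
      unfolding eq using p(1) assms(4)
      by (intro path_weight_suffix_le[of E]) (auto simp: graph_paths_def eq)
    ultimately show ?thesis using p(2) uv(2) by force
  next
    case False
    obtain p' where eq: "p = v # p'"
      using p(1) by (cases p) (auto simp: graph_paths_def)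
    have "u # p \<in> graph_paths V E u z"
      using p(1) False uv walk_step(1) by (auto simp: graph_paths_def eq)
    then show ?thesis using p(2) by (intro bexI[of _ "u # p"]) (auto simp: eq)
  qed
qed

lemma graph_connected_iff:
  assumes "fin_graph V E"
  shows "graph_connected V E \<longleftrightarrow> V \<noteq> {} \<and> (\<forall>u\<in>V. \<forall>v\<in>V. (u, v) \<in> (adj E)\<^sup>*)"
proof -
  have "graph_paths V E u v \<noteq> {} \<longleftrightarrow> (u, v) \<in> (adj E)\<^sup>*" if "v \<in> V" for u v
  proof
    assume "graph_paths V E u v \<noteq> {}"
    then obtain p where "p \<in> graph_paths V E u v" by blast
    then have "walk E (\<lambda>_. 0) u v (path_weight (\<lambda>_. 0) p)"
      using path_walk[of p E] by (auto simp: graph_paths_def)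
    then show "(u, v) \<in> (adj E)\<^sup>*" by (rule walk_reach)
  next
    assume "(u, v) \<in> (adj E)\<^sup>*"
    then obtain w where "walk E (\<lambda>_. 0) u v w" using reach_walk[of u v E "\<lambda>_. 0"] by blast
    from walk_to_path[OF this assms that] show "graph_paths V E u v \<noteq> {}" by auto
  qed
  then show ?thesis by (auto simp: graph_connected_def)
qed

lemma graph_connectedI_root:
  assumes "fin_graph V E" "s \<in> V" "\<And>v. v \<in> V \<Longrightarrow> (s, v) \<in> (adj E)\<^sup>*"
  shows "graph_connected V E"
  unfolding graph_connected_iff[OF assms(1)]
proof (intro conjI ballI)
  fix u v assume "u \<in> V" "v \<in> V"
  then have "(u, s) \<in> (adj E)\<^sup>*" "(s, v) \<in> (adj E)\<^sup>*"
    using assms(3) sym_reach by metis+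
  then show "(u, v) \<in> (adj E)\<^sup>*" by (rule rtrancl_trans)
qed (use assms(2) in auto)

lemma graph_connectedD:
  assumes "fin_graph V E" "graph_connected V E" "u \<in> V" "v \<in> V"
  shows "(u, v) \<in> (adj E)\<^sup>*"
  using assms(2-4) by (simp add: graph_connected_iff[OF assms(1)])

text \<open>Every edge is a bridge: its end points are disconnected by its removal. For connected graphs
  this is equivalent to being a tree, and it is preserved when graphs are joined by an edge.\<close>

definition all_bridges :: "'v set set \<Rightarrow> bool" where
  "all_bridges E \<longleftrightarrow> (\<forall>a b. {a, b} \<in> E \<longrightarrow> (a, b) \<notin> (adj (E - {{a, b}}))\<^sup>*)"

lemma graph_treeI:
  assumes "fin_graph V E" "graph_connected V E" "all_bridges E"
  shows "graph_tree V E"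
proof -
  have False if p: "graph_cycle V E p" for p
  proof -
    let ?E = "E - {{last p, hd p}}"
    have len: "3 \<le> length p" and dist: "distinct p" and suc: "successively (\<lambda>x y. {x, y} \<in> E) p"
      and closing: "{last p, hd p} \<in> E"
      using p by (auto simp: graph_cycle_def)
    have ne: "p \<noteq> []" using len by auto
    have "successively (\<lambda>x y. {x, y} \<in> ?E) p"
      unfolding successively_conv_nth
    proof (intro allI impI)
      fix i assume i: "Suc i < length p"
      have "{p ! i, p ! Suc i} \<noteq> {last p, hd p}"
        using dist len i ne
        by (auto simp: doubleton_eq_iff last_conv_nth hd_conv_nth nth_eq_iff_index_eq)
      then show "{p ! i, p ! Suc i} \<in> ?E"
        using suc i by (auto simp: successively_conv_nth)
    qed
    then have "(hd p, last p) \<in> (adj ?E)\<^sup>*"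
      using path_walk[OF ne] walk_reach by metis
    then have "(last p, hd p) \<in> (adj ?E)\<^sup>*" by (rule sym_reach)
    with assms(3) closing show False by (simp add: all_bridges_def)
  qed
  then show ?thesis using assms by (auto simp: graph_tree_def)
qed

lemma graph_connected_delete:
  assumes "fin_graph V E" "graph_connected V E" "(a, b) \<in> (adj (E - {{a, b}}))\<^sup>*"
  shows "graph_connected V (E - {{a, b}})"
proof -
  have "(u, v) \<in> (adj (E - {{a, b}}))\<^sup>*" if "u \<in> V" "v \<in> V" for u v
  proof (rule reach_map[where f = "\<lambda>x. x", OF graph_connectedD[OF assms(1,2) that]])
    fix x y assume xy: "{x, y} \<in> E"
    show "(x, y) \<in> (adj (E - {{a, b}}))\<^sup>*"
    proof (cases "{x, y} = {a, b}")
      case True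
      then show ?thesis using assms(3) sym_reach by (auto simp: doubleton_eq_iff)
    next
      case False
      then show ?thesis using xy by (intro adj_reach) auto
    qed
  qed
  moreover have "V \<noteq> {}" using assms(2) by (simp add: graph_connected_def)
  ultimately show ?thesis
    using graph_connected_iff[OF fin_graph_mono[OF assms(1)]] by blast
qed

text \<open>A connected spanning subgraph with the least number of edges has only bridges.\<close>

lemma spanning_tree_exists:
  assumes "fin_graph V E" "graph_connected V E"
  obtains F where "F \<subseteq> E" "graph_tree V F"
proof -
  obtain F where F: "F \<subseteq> E \<and> graph_connected V F"
    and least: "\<And>F'. F' \<subseteq> E \<and> graph_connected V F' \<Longrightarrow> card F \<le> card F'"
    using ex_has_least_nat[of "\<lambda>F. F \<subseteq> E \<and> graph_connected V F" E card] assms(2) by blast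
  have fg: "fin_graph V F" using F fin_graph_mono[OF assms(1)] by blast
  have "all_bridges F"
    unfolding all_bridges_def
  proof (intro allI impI notI)
    fix a b assume ab: "{a, b} \<in> F" "(a, b) \<in> (adj (F - {{a, b}}))\<^sup>*"
    then have "card F \<le> card (F - {{a, b}})"
      using F by (intro least) (auto intro: graph_connected_delete[OF fg])
    then show False
      using ab(1) fin_graph_finite_edges[OF fg] by (metis card_Diff1_less not_less)
  qed
  with F fg that show thesis by (blast intro: graph_treeI)
qed

text \<open>The first edge of a path from \<open>u\<close> to \<open>v\<close> becomes redundant once \<open>u\<close> and \<open>v\<close> are joined by a
  new edge.\<close>

lemma exchange_edge:
  assumes "fin_graph V E" "graph_connected V E" "u \<in> V" "v \<in> V" "u \<noteq> v" "{u, v} \<notin> E"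
  obtains e where "e \<in> E" "fin_graph V (insert {u, v} (E - {e}))"
    "graph_connected V (insert {u, v} (E - {e}))"
proof -
  obtain p where p: "p \<in> graph_paths V E u v"
    using assms(2-4) by (auto simp: graph_connected_def)
  obtain x q where pq: "p = u # x # q"
    using p assms(5) by (cases p; cases "tl p") (auto simp: graph_paths_def split: if_splits)
  let ?e = "{u, x}" let ?F = "insert {u, v} E"
  have xv: "x \<noteq> v" "?e \<in> E" using p assms(6) by (auto simp: pq graph_paths_def)
  have fg: "fin_graph V ?F" using assms by (auto simp: fin_graph_def)
  have conn: "graph_connected V ?F"
    using assms(2) unfolding graph_connected_iff[OF assms(1)] graph_connected_iff[OF fg]
    by (meson reach_mono subset_insertI)
  have eq: "?F - {?e} = insert {u, v} (E - {?e})"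
    using xv by (auto simp: doubleton_eq_iff)
  have "successively (\<lambda>x y. {x, y} \<in> E - {?e}) (x # q)"
  proof -
    have "successively (\<lambda>a b. {a, b} \<in> E) (x # q)" "u \<notin> set (x # q)"
      using p by (auto simp: pq graph_paths_def)
    then show ?thesis
      by (auto simp: doubleton_eq_iff elim!: successively_mono[rotated]
               intro: successively_mono[of _ "x # q"])
  qed
  from path_walk[OF _ this, of "\<lambda>_. 0"] have "(x, v) \<in> (adj (E - {?e}))\<^sup>*"
    using p by (auto simp: pq graph_paths_def dest: walk_reach)
  then have "(v, x) \<in> (adj (?F - {?e}))\<^sup>*"
    unfolding eq by (meson reach_mono subset_insertI sym_reach)
  moreover have "(u, v) \<in> (adj (?F - {?e}))\<^sup>*"
    unfolding eq by (intro adj_reach) auto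
  ultimately have "(u, x) \<in> (adj (?F - {?e}))\<^sup>*" by (rule rtrancl_trans[rotated])
  from graph_connected_delete[OF fg conn this] fin_graph_mono[OF fg, of "?F - {?e}"] show thesis
    using that[of ?e] xv(2) eq by auto
qed

section \<open>Rooted binary trees\<close>

lemma reach_stays:
  assumes "(s, t) \<in> (adj (E1 \<union> E2))\<^sup>*" "fin_graph V1 E1" "fin_graph V2 E2" "V1 \<inter> V2 = {}" "s \<in> V1"
  shows "t \<in> V1"
  using assms(1)
proof (induction rule: rtrancl_induct)
  case (step y z)
  then show ?case
    using assms(2-4) fin_graph_edgeD by (fastforce simp: adj_def)
qed (rule assms(5))

lemma join_bridges:
  assumes "fin_graph V1 E1" "fin_graph V2 E2" "V1 \<inter> V2 = {}" "s \<in> V1" "t \<in> V2"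
    and "all_bridges E1" "{a, b} \<in> E1"
  shows "(a, b) \<notin> (adj (insert {s, t} (E1 \<union> E2) - {{a, b}}))\<^sup>*"
proof
  \<comment> \<open>collapsing the second tree to \<open>s\<close> turns a detour in the joined graph into one in the first\<close>
  define f where "f v = (if v \<in> V1 then v else s)" for v
  assume "(a, b) \<in> (adj (insert {s, t} (E1 \<union> E2) - {{a, b}}))\<^sup>*"
  then have "(f a, f b) \<in> (adj (E1 - {{a, b}}))\<^sup>*"
  proof (rule reach_map)
    fix x y assume xy: "{x, y} \<in> insert {s, t} (E1 \<union> E2) - {{a, b}}"
    then consider "{x, y} = {s, t}" | "{x, y} \<in> E1 - {{a, b}}" | "{x, y} \<in> E2" by blast
    then show "(f x, f y) \<in> (adj (E1 - {{a, b}}))\<^sup>*"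
    proof cases
      case 1
      then show ?thesis using assms(3-5) by (auto simp: f_def doubleton_eq_iff)
    next
      case 2
      then have "f x = x" "f y = y" using fin_graph_edgeD[OF assms(1), of x y] by (auto simp: f_def)
      with 2 show ?thesis by (simp add: adj_reach)
    next
      case 3
      then have "f x = s" "f y = s"
        using fin_graph_edgeD[OF assms(2), of x y] assms(3) by (auto simp: f_def)
      then show ?thesis by simp
    qed
  qed
  moreover have "f a = a" "f b = b"
    using fin_graph_edgeD[OF assms(1,7)] by (auto simp: f_def)
  ultimately show False using assms(6,7) by (auto simp: all_bridges_def)
qed

lemma fin_graph_Un:
  assumes "fin_graph V1 E1" "fin_graph V2 E2"
  shows "fin_graph (V1 \<union> V2) (E1 \<union> E2)"
  unfolding fin_graph_def
proof (intro conjI ballI)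
  fix e assume "e \<in> E1 \<union> E2"
  then consider "e \<in> E1" | "e \<in> E2" by blast
  then show "\<exists>u\<in>V1 \<union> V2. \<exists>v\<in>V1 \<union> V2. u \<noteq> v \<and> e = {u, v}"
  proof cases
    case 1
    then show ?thesis by (rule fin_graph_edgeE[OF assms(1)]) blast
  next
    case 2
    then show ?thesis by (rule fin_graph_edgeE[OF assms(2)]) blast
  qed
qed (use assms in \<open>simp add: fin_graph_def\<close>)

lemma fin_graph_join:
  assumes "fin_graph V1 E1" "fin_graph V2 E2" "V1 \<inter> V2 = {}" "s \<in> V1" "t \<in> V2"
  shows "fin_graph (V1 \<union> V2) (insert {s, t} (E1 \<union> E2))"
proof -
  have "s \<noteq> t" using assms(3-5) by blast
  then show ?thesis
    using fin_graph_Un[OF assms(1,2)] assms(4,5) by (auto simp: fin_graph_def)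
qed

lemma graph_connected_join:
  assumes "fin_graph V1 E1" "fin_graph V2 E2" "V1 \<inter> V2 = {}" "s \<in> V1" "t \<in> V2"
    and "graph_connected V1 E1" "graph_connected V2 E2"
  shows "graph_connected (V1 \<union> V2) (insert {s, t} (E1 \<union> E2))"
proof (rule graph_connectedI_root[OF fin_graph_join[OF assms(1-5)]])
  fix v assume "v \<in> V1 \<union> V2"
  then consider "(s, v) \<in> (adj E1)\<^sup>*" | "(t, v) \<in> (adj E2)\<^sup>*"
    using graph_connectedD assms by (metis UnE)
  then show "(s, v) \<in> (adj (insert {s, t} (E1 \<union> E2)))\<^sup>*"
  proof cases
    case 1
    then show ?thesis by (rule reach_mono) auto
  next
    case 2
    then have "(t, v) \<in> (adj (insert {s, t} (E1 \<union> E2)))\<^sup>*" by (rule reach_mono) auto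
    moreover have "(s, t) \<in> (adj (insert {s, t} (E1 \<union> E2)))\<^sup>*" by (rule adj_reach) simp
    ultimately show ?thesis by (rule rtrancl_trans[rotated])
  qed
qed (use assms in simp)

lemma all_bridges_join:
  assumes "fin_graph V1 E1" "fin_graph V2 E2" "V1 \<inter> V2 = {}" "s \<in> V1" "t \<in> V2"
    and "all_bridges E1" "all_bridges E2"
  shows "all_bridges (insert {s, t} (E1 \<union> E2))"
  unfolding all_bridges_def
proof (intro allI impI)
  fix a b assume "{a, b} \<in> insert {s, t} (E1 \<union> E2)"
  then consider "{a, b} = {s, t}" | "{a, b} \<in> E1" | "{a, b} \<in> E2" by blast
  then show "(a, b) \<notin> (adj (insert {s, t} (E1 \<union> E2) - {{a, b}}))\<^sup>*"
  proof cases
    case 1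
    have "(s, t) \<notin> (adj (E1 \<union> E2))\<^sup>*"
      using reach_stays[OF _ assms(1-4)] assms(3,5) by blast
    then have "(s, t) \<notin> (adj (insert {s, t} (E1 \<union> E2) - {{s, t}}))\<^sup>*"
      using reach_mono[of s t _ "E1 \<union> E2"] by blast
    then show ?thesis
      using 1 sym_reach by (metis doubleton_eq_iff)
  next
    case 2
    then show ?thesis using join_bridges[OF assms(1-6)] by blast
  next
    case 3
    have "insert {t, s} (E2 \<union> E1) = insert {s, t} (E1 \<union> E2)" by (simp add: Un_commute insert_commute)
    then show ?thesis
      using join_bridges[OF assms(2,1) _ assms(5,4,7) 3] assms(3) by (simp add: Int_commute)
  qed
qed

lemma vertex_degree_join:
  assumes "fin_graph V1 E1" "fin_graph V2 E2" "V1 \<inter> V2 = {}" "s \<in> V1" "t \<in> V2" "v \<in> V1"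
  shows "vertex_degree (insert {s, t} (E1 \<union> E2)) v = vertex_degree E1 v + of_bool (v = s)"
proof -
  have 0: "v \<notin> e" if "e \<in> E2" for e
    using that fin_graph_edgeE[OF assms(2), of e] assms(3,6) by blast
  have 1: "t \<notin> e" if "e \<in> E1" for e
    using that fin_graph_edgeE[OF assms(1), of e] assms(3,5) by blast
  have fin: "finite {e \<in> E1. v \<in> e}" using fin_graph_finite_edges[OF assms(1)] by simp
  have "v \<noteq> t" using assms by blast
  then have "{e \<in> insert {s, t} (E1 \<union> E2). v \<in> e} =
      (if v = s then insert {s, t} {e \<in> E1. v \<in> e} else {e \<in> E1. v \<in> e})"
    using 0 by auto
  moreover have "{s, t} \<notin> E1" using 1 by blast
  ultimately show ?thesis
    using fin by (cases "v = s") (simp_all add: vertex_degree_def)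
qed

text \<open>Rooted binary trees, in which every vertex has either two children or none. The arguments are
  the vertices, the edges, the root and the set of leaves; a single vertex is both root and leaf.\<close>

inductive rooted_binary_tree :: "'v set \<Rightarrow> 'v set set \<Rightarrow> 'v \<Rightarrow> 'v set \<Rightarrow> bool" where
  rbt_leaf: "rooted_binary_tree {v} {} v {v}"
| rbt_node: "\<lbrakk>rooted_binary_tree V1 E1 y A; rooted_binary_tree V2 E2 z B; V1 \<inter> V2 = {};
     x \<notin> V1; x \<notin> V2\<rbrakk> \<Longrightarrow>
   rooted_binary_tree (insert x V1 \<union> V2) (insert {x, z} (insert {x, y} E1 \<union> E2)) x (A \<union> B)"

text \<open>The graph-theoretic content of a rooted binary tree. Adding one to the degree of the root
  accounts for the edge by which the tree is attached to a parent; then all degrees are \<open>1\<close> at leaves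
  and \<open>3\<close> elsewhere, also for a single vertex.\<close>

definition rbt_graph :: "'v set \<Rightarrow> 'v set set \<Rightarrow> 'v \<Rightarrow> 'v set \<Rightarrow> bool" where
  "rbt_graph V E x A \<longleftrightarrow> fin_graph V E \<and> graph_connected V E \<and> all_bridges E \<and> x \<in> V \<and> A \<subseteq> V \<and>
     (\<forall>v\<in>V. vertex_degree E v + of_bool (v = x) = (if v \<in> A then 1 else 3))"

lemma single_vertex_graph: "fin_graph {v} {}" "graph_connected {v} {}" "all_bridges {}"
proof -
  show "fin_graph {v} {}" by (simp add: fin_graph_def)
  then show "graph_connected {v} {}" by (simp add: graph_connected_iff)
qed (simp add: all_bridges_def)

lemma rooted_binary_tree_graph: "rooted_binary_tree V E x A \<Longrightarrow> rbt_graph V E x A"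
proof (induction rule: rooted_binary_tree.induct)
  case (rbt_leaf v)
  then show ?case by (simp add: rbt_graph_def single_vertex_graph vertex_degree_def)
next
  case (rbt_node V1 E1 y A V2 E2 z B x)
  note [simp] = single_vertex_graph
  have 1: "fin_graph V1 E1" "graph_connected V1 E1" "all_bridges E1" "y \<in> V1" "A \<subseteq> V1"
    "\<And>v. v \<in> V1 \<Longrightarrow> vertex_degree E1 v + of_bool (v = y) = (if v \<in> A then 1 else 3)"
    using rbt_node.IH(1) by (auto simp: rbt_graph_def)
  have 2: "fin_graph V2 E2" "graph_connected V2 E2" "all_bridges E2" "z \<in> V2" "B \<subseteq> V2"
    "\<And>v. v \<in> V2 \<Longrightarrow> vertex_degree E2 v + of_bool (v = z) = (if v \<in> B then 1 else 3)"
    using rbt_node.IH(2) by (auto simp: rbt_graph_def)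
  let ?V = "insert x V1" let ?E = "insert {x, y} E1"
  have E: "?E = insert {x, y} ({} \<union> E1)" and V: "?V = {x} \<union> V1" by auto
  have d1: "{x} \<inter> V1 = {}" "V1 \<inter> {x} = {}" using rbt_node by auto
  have 3: "fin_graph ?V ?E" "graph_connected ?V ?E" "all_bridges ?E"
    unfolding E V
    by (intro fin_graph_join graph_connected_join all_bridges_join[where ?V1.0 = "{x}" and ?V2.0 = V1];
        use 1 d1 in simp)+
  have deg: "vertex_degree ?E v + of_bool (v = x) = (if v \<in> A then 1 else if v = x then 2 else 3)"
    if "v \<in> ?V" for v
  proof (cases "v = x")
    case True
    then show ?thesis
      using vertex_degree_join[OF _ 1(1) d1(1), of "{}" x y x] 1(4,5) rbt_node.hyps
      by (auto simp: vertex_degree_def)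
  next
    case False
    then show ?thesis
      using vertex_degree_join[OF 1(1) _ d1(2), of "{}" y x v] 1(4,6) that
      by (auto simp: vertex_degree_def insert_commute)
  qed
  have d2: "?V \<inter> V2 = {}" using rbt_node by auto
  have 4: "vertex_degree (insert {x, z} (?E \<union> E2)) v + of_bool (v = x) = (if v \<in> A \<union> B then 1 else 3)"
    if "v \<in> ?V \<union> V2" for v
  proof (cases "v \<in> ?V")
    case True
    then show ?thesis
      using vertex_degree_join[OF 3(1) 2(1) d2, of x z v] 2(4,5) deg[OF True] d2 1(5) rbt_node.hyps
      by (auto split: if_splits)
  next
    case False
    then have "v \<in> V2" "v \<noteq> x" "v \<notin> A" using that 1(5) by auto
    then show ?thesis
      using vertex_degree_join[OF 2(1) 3(1), of z x v] 2(4) 2(6)[of v] d2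
      by (auto simp: Un_commute insert_commute Int_commute)
  qed
  have 5: "fin_graph (?V \<union> V2) (insert {x, z} (?E \<union> E2))"
    "graph_connected (?V \<union> V2) (insert {x, z} (?E \<union> E2))" "all_bridges (insert {x, z} (?E \<union> E2))"
    using 2(4)
    by (intro fin_graph_join[OF 3(1) 2(1) d2] graph_connected_join[OF 3(1) 2(1) d2 _ _ 3(2) 2(2)]
        all_bridges_join[OF 3(1) 2(1) d2 _ _ 3(3) 2(3)]; simp)+
  show ?case
    unfolding rbt_graph_def using 4 5 1(5) 2(5) by blast
qed

text \<open>A further leaf \<open>r\<close> attached to the root turns a rooted binary tree into a binary tree.\<close>

lemma planted_binary_tree:
  assumes "rooted_binary_tree V E x A" "r \<notin> V"
  shows "binary_tree (insert r V) (insert {r, x} E) (insert r A)"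
proof -
  have 1: "fin_graph V E" "graph_connected V E" "all_bridges E" "x \<in> V" "A \<subseteq> V"
    "\<And>v. v \<in> V \<Longrightarrow> vertex_degree E v + of_bool (v = x) = (if v \<in> A then 1 else 3)"
    using rooted_binary_tree_graph[OF assms(1)] by (auto simp: rbt_graph_def)
  note [simp] = single_vertex_graph
  have d: "{r} \<inter> V = {}" "V \<inter> {r} = {}" using assms(2) by auto
  have E: "insert {r, x} E = insert {r, x} ({} \<union> E)" and V: "insert r V = {r} \<union> V" by auto
  have "graph_tree (insert r V) (insert {r, x} E)"
    unfolding E V
    by (intro graph_treeI fin_graph_join graph_connected_join
        all_bridges_join[where ?V1.0 = "{r}" and ?V2.0 = V]; use 1 d in simp)
  moreover have "vertex_degree (insert {r, x} E) r = 1"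
    using vertex_degree_join[OF _ 1(1) d(1), of "{}" r x r] 1(4) by (simp add: vertex_degree_def)
  moreover have "vertex_degree (insert {r, x} E) v = (if v \<in> A then 1 else 3)" if "v \<in> V" for v
    using vertex_degree_join[OF 1(1) _ d(2), of "{}" x r v] 1(4) 1(6)[OF that] that
    by (simp add: insert_commute)
  ultimately show ?thesis
    using 1(5) assms(2) unfolding binary_tree_def by (auto split: if_splits)
qed

section \<open>Surgery on networks\<close>

text \<open>Here \<open>C\<close> is the component of a neighbour \<open>t\<close> of \<open>s\<close> after the removal of \<open>s\<close>.\<close>

lemma split_off_component:
  assumes "fin_graph V E" "graph_connected V E" "s \<in> V" "V \<noteq> {s}"
  obtains t C where "t \<in> C" "C \<subseteq> V" "s \<notin> C" "{s, t} \<in> E"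
    "fin_graph C {e \<in> E. e \<subseteq> C}" "graph_connected C {e \<in> E. e \<subseteq> C}"
    "fin_graph (V - C) {e \<in> E. e \<inter> C = {}}" "graph_connected (V - C) {e \<in> E. e \<inter> C = {}}"
proof -
  obtain v where v: "v \<in> V" "v \<noteq> s" using assms(3,4) by blast
  then obtain t where st: "{s, t} \<in> E"
    using graph_connectedD[OF assms(1-3) v(1)]
    by (auto simp: adj_def elim: converse_rtranclE)
  have t: "t \<in> V" "t \<noteq> s" using fin_graph_edgeD[OF assms(1) st] by auto
  define E0 where "E0 = {e \<in> E. s \<notin> e}"
  define C where "C = {v. (t, v) \<in> (adj E0)\<^sup>*}"
  have "t \<in> C" by (simp add: C_def)
  have "s \<notin> C"
  proof
    assume "s \<in> C"
    then have "(t, s) \<in> (adj E0)\<^sup>*" by (simp add: C_def)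
    then show False using t(2) by (cases rule: rtranclE) (auto simp: adj_def E0_def)
  qed
  have CV: "C \<subseteq> V"
  proof
    fix v assume "v \<in> C"
    then have "(t, v) \<in> (adj E0)\<^sup>*" by (simp add: C_def)
    then show "v \<in> V"
    proof (induction rule: rtrancl_induct)
      case (step y z)
      then show ?case using fin_graph_edgeD[OF assms(1), of y z] by (auto simp: adj_def E0_def)
    qed (rule t)
  qed
  have closed: "v \<in> C" if "u \<in> C" "{u, v} \<in> E" "v \<noteq> s" for u v
  proof -
    have "(u, v) \<in> adj E0" using that \<open>s \<notin> C\<close> by (auto simp: adj_def E0_def)
    then show ?thesis using that(1) by (auto simp: C_def intro: rtrancl_into_rtrancl)
  qed
  let ?E1 = "{e \<in> E. e \<inter> C = {}}" and ?E2 = "{e \<in> E. e \<subseteq> C}"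
  have fin: "finite V" using assms(1) by (simp add: fin_graph_def)
  have fg2: "fin_graph C ?E2"
    unfolding fin_graph_def
  proof (intro conjI ballI)
    fix e assume e: "e \<in> ?E2"
    then have "e \<in> E" by simp
    then obtain u v where "e = {u, v}" "u \<in> V" "v \<in> V" "u \<noteq> v"
      by (rule fin_graph_edgeE[OF assms(1)])
    with e show "\<exists>u\<in>C. \<exists>v\<in>C. u \<noteq> v \<and> e = {u, v}" by blast
  qed (rule finite_subset[OF CV fin])
  have fg1: "fin_graph (V - C) ?E1"
    unfolding fin_graph_def
  proof (intro conjI ballI)
    fix e assume e: "e \<in> ?E1"
    then have "e \<in> E" by simp
    then obtain u v where "e = {u, v}" "u \<in> V" "v \<in> V" "u \<noteq> v"
      by (rule fin_graph_edgeE[OF assms(1)])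
    with e show "\<exists>u\<in>V - C. \<exists>v\<in>V - C. u \<noteq> v \<and> e = {u, v}" by blast
  qed (use fin in simp)
  have conn2: "graph_connected C ?E2"
  proof (rule graph_connectedI_root[OF fg2 \<open>t \<in> C\<close>])
    fix v assume "v \<in> C"
    then have "(t, v) \<in> (adj E0)\<^sup>*" by (simp add: C_def)
    then show "(t, v) \<in> (adj ?E2)\<^sup>*"
    proof (induction rule: rtrancl_induct)
      case (step y z)
      then have "y \<in> C" by (simp add: C_def)
      moreover have "z \<in> C" using step by (auto simp: C_def intro: rtrancl_into_rtrancl)
      ultimately have "(y, z) \<in> adj ?E2" using step(2) by (auto simp: adj_def E0_def)
      with step(3) show ?case by (rule rtrancl_into_rtrancl)
    qed simp
  qed
  have conn1: "graph_connected (V - C) ?E1"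
  proof (rule graph_connectedI_root[OF fg1])
    show "s \<in> V - C" using \<open>s \<notin> C\<close> assms(3) by simp
    \<comment> \<open>only \<open>s\<close> outside \<open>C\<close> is adjacent to \<open>C\<close>, so collapsing \<open>C\<close> to \<open>s\<close> keeps walks\<close>
    define f where "f v = (if v \<in> C then s else v)" for v
    fix v assume v: "v \<in> V - C"
    have "(f s, f v) \<in> (adj ?E1)\<^sup>*"
    proof (rule reach_map[OF graph_connectedD[OF assms(1-3)]])
      fix a b assume ab: "{a, b} \<in> E"
      consider "a \<in> C" "b \<in> C" | "a \<in> C" "b \<notin> C" | "a \<notin> C" "b \<in> C" | "a \<notin> C" "b \<notin> C" by blast
      then show "(f a, f b) \<in> (adj ?E1)\<^sup>*"
      proof cases
        case 2
        then have "b = s" using closed ab by blast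
        with 2 show ?thesis by (simp add: f_def)
      next
        case 3
        then have "a = s" using closed[of b a] ab by (auto simp: insert_commute)
        with 3 show ?thesis by (simp add: f_def)
      next
        case 4
        then show ?thesis using ab by (intro adj_reach) (auto simp: f_def)
      qed (simp add: f_def)
    qed (use v in simp)
    then show "(s, v) \<in> (adj ?E1)\<^sup>*" using v \<open>s \<notin> C\<close> by (simp add: f_def)
  qed
  show thesis by (rule that[OF \<open>t \<in> C\<close> CV \<open>s \<notin> C\<close> st fg2 conn2 fg1 conn1])
qed

context Pseudometric_space
begin

lemma edge_length_pair [simp]: "edge_length d \<Gamma> {v, w} = d (\<Gamma> v) (\<Gamma> w)"
  by (rule edge_length_doubleton[OF commute])

lemma edge_length_nonneg: "fin_graph V E \<Longrightarrow> e \<in> E \<Longrightarrow> 0 \<le> edge_length d \<Gamma> e"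
  by (erule (1) fin_graph_edgeE) (simp add: nonneg)

lemma network_length_nonneg: "fin_graph V E \<Longrightarrow> 0 \<le> network_length d E \<Gamma>"
  unfolding network_length_def by (intro sum_nonneg edge_length_nonneg)

lemma network_length_cong:
  assumes "fin_graph V E" "\<And>v. v \<in> V \<Longrightarrow> \<Gamma> v = \<Gamma>' v"
  shows "network_length d E \<Gamma> = network_length d E \<Gamma>'"
  unfolding network_length_def
proof (rule sum.cong)
  fix e assume "e \<in> E"
  with assms(1) show "edge_length d \<Gamma> e = edge_length d \<Gamma>' e"
    by (rule fin_graph_edgeE) (simp add: assms(2))
qed simp

lemma network_length_insert_le:
  assumes "fin_graph V E"
  shows "network_length d (insert {u, v} E) \<Gamma> \<le> d (\<Gamma> u) (\<Gamma> v) + network_length d E \<Gamma>"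
proof (cases "{u, v} \<in> E")
  case True
  then show ?thesis using nonneg by (simp add: insert_absorb)
next
  case False
  then show ?thesis using fin_graph_finite_edges[OF assms] by (simp add: network_length_def)
qed

lemma network_length_Un_le:
  assumes "fin_graph V1 E1" "fin_graph V2 E2"
  shows "network_length d (E1 \<union> E2) \<Gamma> \<le> network_length d E1 \<Gamma> + network_length d E2 \<Gamma>"
proof -
  have "network_length d (E1 \<union> E2) \<Gamma> + network_length d (E1 \<inter> E2) \<Gamma> =
      network_length d E1 \<Gamma> + network_length d E2 \<Gamma>"
    unfolding network_length_def
    using assms fin_graph_finite_edges by (intro sum.union_inter) blast+
  moreover have "0 \<le> network_length d (E1 \<inter> E2) \<Gamma>"
    using network_length_nonneg fin_graph_mono[OF assms(1)] by blast
  ultimately show ?thesis by linarith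
qed

text \<open>The map \<open>lab\<close> prescribes the leaves, and \<open>I\<close> is a supply of inner vertices; a rooted binary tree
  with \<open>n\<close> leaves has \<open>n - 1\<close> inner vertices. Working with a given finite supply keeps the vertex set
  of all trees that arise inside one finite set.\<close>

lemma rooted_binary_tree_of_network:
  assumes "fin_graph V E" "graph_connected V E" "s \<in> V" "\<Gamma> ` V \<subseteq> M"
    and "N \<subseteq> \<Gamma> ` V" "N \<noteq> {}" "inj_on lab N" "finite I" "lab ` N \<inter> I = {}" "card N \<le> Suc (card I)"
  shows "\<exists>V' E' x \<Gamma>'. rooted_binary_tree V' E' x (lab ` N) \<and> V' \<subseteq> lab ` N \<union> I \<and> \<Gamma>' ` V' \<subseteq> M \<and>
    (\<forall>n\<in>N. \<Gamma>' (lab n) = n) \<and> network_length d E' \<Gamma>' + d (\<Gamma> s) (\<Gamma>' x) \<le> network_length d E \<Gamma>"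
  using assms
proof (induction "card V" arbitrary: V E s N I rule: less_induct)
  case less
  have finV: "finite V" using less.prems(1) by (simp add: fin_graph_def)
  have sM: "\<Gamma> s \<in> M" using less.prems by blast
  show ?case
  proof (cases "V = {s}")
    case True
    then have N: "N = {\<Gamma> s}" using less.prems by auto
    show ?thesis
      using N sM network_length_nonneg[OF less.prems(1), of \<Gamma>] rbt_leaf[of "lab (\<Gamma> s)"]
      by (intro exI[of _ "{lab (\<Gamma> s)}"] exI[of _ "{}"] exI[of _ "lab (\<Gamma> s)"] exI[of _ "\<lambda>_. \<Gamma> s"])
        (simp add: refl network_length_def)
  next
    case False
    obtain t C where C: "t \<in> C" "C \<subseteq> V" "s \<notin> C" "{s, t} \<in> E"
      "fin_graph C {e \<in> E. e \<subseteq> C}" "graph_connected C {e \<in> E. e \<subseteq> C}"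
      "fin_graph (V - C) {e \<in> E. e \<inter> C = {}}" "graph_connected (V - C) {e \<in> E. e \<inter> C = {}}"
      using split_off_component[OF less.prems(1-3) False] .
    let ?E1 = "{e \<in> E. e \<inter> C = {}}" and ?E2 = "{e \<in> E. e \<subseteq> C}"
    have c1: "card (V - C) < card V" and c2: "card C < card V"
      using C(1-3) less.prems(3) finV by (auto intro!: psubset_card_mono)
    have s1: "s \<in> V - C" using C(3) less.prems(3) by simp
    have g1: "\<Gamma> ` (V - C) \<subseteq> M" and g2: "\<Gamma> ` C \<subseteq> M" using less.prems(4) C(2) by blast+
    have tM: "\<Gamma> t \<in> M" using g2 C(1) by blast
    have len: "network_length d ?E1 \<Gamma> + (d (\<Gamma> s) (\<Gamma> t) + network_length d ?E2 \<Gamma>) \<le>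
        network_length d E \<Gamma>"
    proof -
      have fin: "finite E" by (rule fin_graph_finite_edges[OF less.prems(1)])
      have "{} \<notin> E" using fin_graph_edgeE[OF less.prems(1), of "{}"] by blast
      then have disj: "?E1 \<inter> insert {s, t} ?E2 = {}" using C(1) by (auto simp: Int_absorb2)
      have "network_length d ?E1 \<Gamma> + (d (\<Gamma> s) (\<Gamma> t) + network_length d ?E2 \<Gamma>) =
          network_length d (?E1 \<union> insert {s, t} ?E2) \<Gamma>"
        unfolding network_length_def using fin disj C(3) by (subst sum.union_disjoint) auto
      also have "\<dots> \<le> network_length d E \<Gamma>"
        unfolding network_length_def
        using fin C(4) edge_length_nonneg[OF less.prems(1)] by (intro sum_mono2) auto
      finally show ?thesis .
    qed
    let ?N1 = "N \<inter> \<Gamma> ` (V - C)" and ?N2 = "N - \<Gamma> ` (V - C)"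
    have N2: "?N2 \<subseteq> \<Gamma> ` C" using less.prems(5) by blast
    have finN: "finite N" using finite_subset[OF less.prems(5)] finV by blast
    consider "?N1 = {}" | "?N2 = {}" | "?N1 \<noteq> {}" "?N2 \<noteq> {}" by blast
    then show ?thesis
    proof cases
      case 1
      then have "N \<subseteq> \<Gamma> ` C" using N2 by blast
      from less.hyps[OF c2 C(5,6,1) g2 this less.prems(6-10)] obtain V' E' x \<Gamma>' where
        *: "rooted_binary_tree V' E' x (lab ` N)" "V' \<subseteq> lab ` N \<union> I" "\<Gamma>' ` V' \<subseteq> M"
          "\<forall>n\<in>N. \<Gamma>' (lab n) = n" "network_length d E' \<Gamma>' + d (\<Gamma> t) (\<Gamma>' x) \<le> network_length d ?E2 \<Gamma>"
        by blast
      have "x \<in> V'" using rooted_binary_tree_graph[OF *(1)] by (simp add: rbt_graph_def)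
      then have "d (\<Gamma> s) (\<Gamma>' x) \<le> d (\<Gamma> s) (\<Gamma> t) + d (\<Gamma> t) (\<Gamma>' x)"
        using *(3) sM tM by (intro triangle) auto
      then have "network_length d E' \<Gamma>' + d (\<Gamma> s) (\<Gamma>' x) \<le> network_length d E \<Gamma>"
        using *(5) len network_length_nonneg[OF C(7), of \<Gamma>] by linarith
      with *(1-4) show ?thesis by blast
    next
      case 2
      then have "N \<subseteq> \<Gamma> ` (V - C)" by blast
      from less.hyps[OF c1 C(7,8) s1 g1 this less.prems(6-10)] obtain V' E' x \<Gamma>' where
        *: "rooted_binary_tree V' E' x (lab ` N)" "V' \<subseteq> lab ` N \<union> I" "\<Gamma>' ` V' \<subseteq> M"
          "\<forall>n\<in>N. \<Gamma>' (lab n) = n" "network_length d E' \<Gamma>' + d (\<Gamma> s) (\<Gamma>' x) \<le> network_length d ?E1 \<Gamma>"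
        by blast
      have "network_length d E' \<Gamma>' + d (\<Gamma> s) (\<Gamma>' x) \<le> network_length d E \<Gamma>"
        using *(5) len network_length_nonneg[OF C(5), of \<Gamma>] nonneg[of "\<Gamma> s" "\<Gamma> t"] by linarith
      with *(1-4) show ?thesis by blast
    next
      case 3
      have cN: "card ?N1 + card ?N2 = card N"
        using finN by (metis card_Int_Diff)
      have pos: "card ?N1 > 0" "card ?N2 > 0" using 3 finN by (auto simp: card_gt_0_iff)
      have "I \<noteq> {}" using cN pos less.prems(10) by auto
      then obtain x where x: "x \<in> I" by blast
      have cI: "card (I - {x}) + 2 \<ge> card ?N1 + card ?N2"
        using x less.prems(8,10) cN by (simp add: card_Diff_singleton)
      then obtain I1 where I1: "I1 \<subseteq> I - {x}" "card I1 = card ?N1 - 1" "finite I1"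
        using pos by (elim obtain_subset_with_card_n[rotated]) linarith
      define I2 where "I2 = I - {x} - I1"
      have I2: "card I2 = card (I - {x}) - card I1" "finite I2"
        using I1 less.prems(8) by (auto simp: I2_def card_Diff_subset)
      have lN: "lab ` ?N1 \<inter> I1 = {}" "lab ` ?N2 \<inter> I2 = {}"
        using less.prems(9) I1(1) by (auto simp: I2_def)
      have inj: "inj_on lab ?N1" "inj_on lab ?N2"
        using less.prems(7) by (auto intro: inj_on_subset)
      \<comment> \<open>\<open>x\<close> becomes the new root, and \<open>I1\<close>, \<open>I2\<close> supply the inner vertices of the two subtrees\<close>
      have cards: "card ?N1 \<le> Suc (card I1)" "card ?N2 \<le> Suc (card I2)"
        using pos cI I1(2) I2(1) by linarith+
      obtain V1 E1 y \<Gamma>1 where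
        1: "rooted_binary_tree V1 E1 y (lab ` ?N1)" "V1 \<subseteq> lab ` ?N1 \<union> I1" "\<Gamma>1 ` V1 \<subseteq> M"
          "\<forall>n\<in>?N1. \<Gamma>1 (lab n) = n" "network_length d E1 \<Gamma>1 + d (\<Gamma> s) (\<Gamma>1 y) \<le> network_length d ?E1 \<Gamma>"
        using less.hyps[OF c1 C(7,8) s1 g1 Int_lower2 3(1) inj(1) I1(3) lN(1) cards(1)]
        by (elim exE conjE) (rule that)
      obtain V2 E2 z \<Gamma>2 where
        2: "rooted_binary_tree V2 E2 z (lab ` ?N2)" "V2 \<subseteq> lab ` ?N2 \<union> I2" "\<Gamma>2 ` V2 \<subseteq> M"
          "\<forall>n\<in>?N2. \<Gamma>2 (lab n) = n" "network_length d E2 \<Gamma>2 + d (\<Gamma> t) (\<Gamma>2 z) \<le> network_length d ?E2 \<Gamma>"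
        using less.hyps[OF c2 C(5,6,1) g2 N2 3(2) inj(2) I2(2) lN(2) cards(2)]
        by (elim exE conjE) (rule that)
      have r1: "fin_graph V1 E1" "y \<in> V1" "lab ` ?N1 \<subseteq> V1"
        and r2: "fin_graph V2 E2" "z \<in> V2" "lab ` ?N2 \<subseteq> V2"
        using rooted_binary_tree_graph[OF 1(1)] rooted_binary_tree_graph[OF 2(1)]
        by (auto simp: rbt_graph_def)
      define L1 L2 where "L1 = lab ` ?N1" and "L2 = lab ` ?N2"
      have L: "L1 \<inter> L2 = {}" "L1 \<union> L2 = lab ` N"
        using less.prems(7) by (auto simp: L1_def L2_def dest: inj_onD)
      have V12: "V1 \<subseteq> L1 \<union> I1" "V2 \<subseteq> L2 \<union> I2"
        using 1(2) 2(2) by (simp_all only: L1_def L2_def)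
      have I12: "I1 \<inter> I2 = {}" "I1 \<subseteq> I" "I2 \<subseteq> I" "x \<notin> I1" "x \<notin> I2"
        using I1(1) by (auto simp: I2_def)
      have LI: "L1 \<inter> I = {}" "L2 \<inter> I = {}"
        using less.prems(9) unfolding L(2)[symmetric] by auto
      have disj: "V1 \<inter> V2 = {}" using V12 L(1) I12 LI by blast
      have xV: "x \<notin> V1" "x \<notin> V2" using V12 I12 LI x by blast+
      define \<Gamma>' where "\<Gamma>' v = (if v \<in> V1 then \<Gamma>1 v else if v \<in> V2 then \<Gamma>2 v else \<Gamma> s)" for v
      have \<Gamma>': "\<And>v. v \<in> V1 \<Longrightarrow> \<Gamma>' v = \<Gamma>1 v" "\<And>v. v \<in> V2 \<Longrightarrow> \<Gamma>' v = \<Gamma>2 v" "\<Gamma>' x = \<Gamma> s"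
        using disj xV by (auto simp: \<Gamma>'_def)
      let ?V = "insert x V1 \<union> V2" and ?E = "insert {x, z} (insert {x, y} E1 \<union> E2)"
      have "rooted_binary_tree ?V ?E x (lab ` N)"
        using rbt_node[OF 1(1) 2(1) disj xV] by (simp only: L1_def[symmetric] L2_def[symmetric] L(2))
      moreover have "?V \<subseteq> lab ` N \<union> I"
        using V12 I12 x unfolding L(2)[symmetric] by blast
      moreover have "\<Gamma>' ` ?V \<subseteq> M"
        using 1(3) 2(3) sM \<Gamma>' by auto
      moreover have "\<Gamma>' (lab n) = n" if "n \<in> N" for n
      proof (cases "n \<in> ?N1")
        case True
        then have "lab n \<in> V1" using r1(3) by blast
        then show ?thesis using \<Gamma>'(1) 1(4) True by simp
      next
        case False
        then have "n \<in> ?N2" using that by blast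
        moreover from this have "lab n \<in> V2" using r2(3) by blast
        ultimately show ?thesis using \<Gamma>'(2) 2(4) by simp
      qed
      moreover have "network_length d ?E \<Gamma>' + d (\<Gamma> s) (\<Gamma>' x) \<le> network_length d E \<Gamma>"
      proof -
        have fx: "fin_graph (insert x V1) (insert {x, y} E1)"
          using fin_graph_join[OF single_vertex_graph(1) r1(1), of x x y] xV r1(2) by simp
        have fU: "fin_graph ?V (insert {x, y} E1 \<union> E2)"
          by (rule fin_graph_Un[OF fx r2(1)])
        have "network_length d ?E \<Gamma>' \<le> d (\<Gamma>' x) (\<Gamma>' z) + network_length d (insert {x, y} E1 \<union> E2) \<Gamma>'"
          by (rule network_length_insert_le[OF fU])
        also have "network_length d (insert {x, y} E1 \<union> E2) \<Gamma>' \<le>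
            network_length d (insert {x, y} E1) \<Gamma>' + network_length d E2 \<Gamma>'"
          by (rule network_length_Un_le[OF fx r2(1)])
        also have "network_length d (insert {x, y} E1) \<Gamma>' \<le> d (\<Gamma>' x) (\<Gamma>' y) + network_length d E1 \<Gamma>'"
          by (rule network_length_insert_le[OF r1(1)])
        also have "network_length d E1 \<Gamma>' = network_length d E1 \<Gamma>1"
          using \<Gamma>'(1) by (rule network_length_cong[OF r1(1)])
        also have "network_length d E2 \<Gamma>' = network_length d E2 \<Gamma>2"
          using \<Gamma>'(2) by (rule network_length_cong[OF r2(1)])
        finally have "network_length d ?E \<Gamma>' \<le> d (\<Gamma> s) (\<Gamma>2 z) +
            (d (\<Gamma> s) (\<Gamma>1 y) + network_length d E1 \<Gamma>1 + network_length d E2 \<Gamma>2)"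
          using \<Gamma>' r1(2) r2(2) by simp
        moreover have "d (\<Gamma> s) (\<Gamma>2 z) \<le> d (\<Gamma> s) (\<Gamma> t) + d (\<Gamma> t) (\<Gamma>2 z)"
          using 2(3) r2(2) sM tM by (intro triangle) auto
        ultimately show ?thesis
          using 1(5) 2(5) len refl[OF sM] \<Gamma>'(3) by simp
      qed
      ultimately show ?thesis by (intro exI conjI ballI)
    qed
  qed
qed

lemma binary_tree_of_network:
  assumes "fin_graph V E" "graph_connected V E" "\<Gamma> ` V \<subseteq> M" "N \<subseteq> \<Gamma> ` V" "2 \<le> card N"
    and "inj_on lab N" "finite I" "lab ` N \<inter> I = {}" "card N \<le> card I"
  obtains V' E' \<Gamma>' where "binary_tree V' E' (lab ` N)" "V' \<subseteq> lab ` N \<union> I" "\<Gamma>' ` V' \<subseteq> M"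
    "\<forall>n\<in>N. \<Gamma>' (lab n) = n" "network_length d E' \<Gamma>' \<le> network_length d E \<Gamma>"
proof -
  have finN: "finite N" using assms(5) by (rule_tac ccontr) simp
  obtain r where r: "r \<in> N" using assms(5) by fastforce
  then obtain s where s: "s \<in> V" "\<Gamma> s = r" using assms(4) by blast
  let ?N = "N - {r}"
  have cN: "card ?N = card N - 1" using r by simp
  have *: "?N \<subseteq> \<Gamma> ` V" "?N \<noteq> {}" "inj_on lab ?N" "lab ` ?N \<inter> I = {}" "card ?N \<le> Suc (card I)"
    using assms(4,6,8,9) by (auto intro: inj_on_subset simp: cN)
      (use cN assms(5) in \<open>metis Diff_eq_empty_iff card.empty diff_is_0_eq not_less_eq_eq numeral_2_eq_2 One_nat_def\<close>)
  from rooted_binary_tree_of_network[OF assms(1,2) s(1) assms(3) *(1-3) assms(7) *(4,5)]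
  obtain V' E' x \<Gamma>' where
    1: "rooted_binary_tree V' E' x (lab ` ?N)" "V' \<subseteq> lab ` ?N \<union> I" "\<Gamma>' ` V' \<subseteq> M"
      "\<forall>n\<in>?N. \<Gamma>' (lab n) = n" "network_length d E' \<Gamma>' + d (\<Gamma> s) (\<Gamma>' x) \<le> network_length d E \<Gamma>"
    by blast
  have r1: "fin_graph V' E'" "x \<in> V'" "lab ` ?N \<subseteq> V'"
    using rooted_binary_tree_graph[OF 1(1)] by (auto simp: rbt_graph_def)
  have "lab r \<notin> lab ` ?N" using assms(6) r by (auto dest: inj_onD)
  then have lr: "lab r \<notin> V'" using 1(2) assms(8) r by blast
  let ?G = "\<Gamma>'(lab r := r)"
  have ins: "insert (lab r) (lab ` ?N) = lab ` N" using r by blast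
  have rM: "r \<in> M" using s assms(3) by blast
  show thesis
  proof
    show "binary_tree (insert (lab r) V') (insert {lab r, x} E') (lab ` N)"
      using planted_binary_tree[OF 1(1) lr] by (simp only: ins)
    show "insert (lab r) V' \<subseteq> lab ` N \<union> I" using 1(2) r by blast
    show "?G ` insert (lab r) V' \<subseteq> M" using 1(3) rM by auto
    have "?G (lab n) = n" if "n \<in> N" for n
      using that 1(4) r1(3) lr by (cases "n = r") auto
    then show "\<forall>n\<in>N. ?G (lab n) = n" by blast
    have "network_length d (insert {lab r, x} E') ?G \<le> d r (\<Gamma>' x) + network_length d E' ?G"
      using network_length_insert_le[OF r1(1), of "lab r" x ?G] r1(2) lr by (auto split: if_splits)
    also have "network_length d E' ?G = network_length d E' \<Gamma>'"
      by (rule network_length_cong[OF r1(1)]) (use lr in auto)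
    finally show "network_length d (insert {lab r, x} E') ?G \<le> network_length d E \<Gamma>"
      using 1(5) unfolding s(2) by linarith
  qed
qed

lemma nondegenerate_tree_of_network:
  assumes "fin_graph V E" "graph_connected V E" "\<Gamma> ` V \<subseteq> M" "N \<subseteq> \<Gamma> ` V"
    and "\<And>x y. x \<in> N \<Longrightarrow> y \<in> N \<Longrightarrow> x \<noteq> y \<Longrightarrow> d x y \<noteq> 0"
  obtains S F where "S \<subseteq> V" "graph_tree S F" "N \<subseteq> \<Gamma> ` S"
    "network_length d F \<Gamma> \<le> network_length d E \<Gamma>" "\<forall>e\<in>F. edge_length d \<Gamma> e \<noteq> 0"
proof -
  \<comment> \<open>\<open>R v u\<close>: \<open>u\<close> is an admissible representative of the class of \<open>v\<close>; this depends only on the class,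
    hence so does the chosen representative \<open>c v\<close>\<close>
  define R where "R v u \<longleftrightarrow> u \<in> V \<and> d (\<Gamma> u) (\<Gamma> v) = 0 \<and> ((\<exists>n\<in>N. d n (\<Gamma> v) = 0) \<longrightarrow> \<Gamma> u \<in> N)" for v u
  define c where "c v = (SOME u. R v u)" for v
  have \<Gamma>M: "\<Gamma> v \<in> M" if "v \<in> V" for v using that assms(3) by blast
  have NM: "n \<in> M" if "n \<in> N" for n using that assms(3,4) by blast
  have zero: "d x z = d y z" if "x \<in> M" "y \<in> M" "z \<in> M" "d x y = 0" for x y z
    using triangle[of x y z] triangle[of y x z] that commute[of x y] by force
  have Rc: "R v (c v)" if v: "v \<in> V" for v
  proof -
    have "\<exists>u. R v u"
    proof (cases "\<exists>n\<in>N. d n (\<Gamma> v) = 0")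
      case True
      then obtain n u where "n \<in> N" "d n (\<Gamma> v) = 0" "u \<in> V" "\<Gamma> u = n" using assms(4) by blast
      then show ?thesis by (auto simp: R_def)
    next
      case False
      then show ?thesis using v refl[OF \<Gamma>M[OF v]] by (auto simp: R_def)
    qed
    then show ?thesis unfolding c_def by (rule someI_ex)
  qed
  then have cV: "c v \<in> V" and c0: "d (\<Gamma> (c v)) (\<Gamma> v) = 0" if "v \<in> V" for v
    using that by (auto simp: R_def)
  have c_eq: "c u = c v" if "u \<in> V" "v \<in> V" "d (\<Gamma> u) (\<Gamma> v) = 0" for u v
  proof -
    have "d x (\<Gamma> u) = d x (\<Gamma> v)" if "x \<in> M" for x
      using zero[of "\<Gamma> u" "\<Gamma> v" x] that \<open>u \<in> V\<close> \<open>v \<in> V\<close> \<open>d (\<Gamma> u) (\<Gamma> v) = 0\<close> \<Gamma>M commute by metis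
    then have "R u = R v"
      using \<Gamma>M NM unfolding R_def fun_eq_iff by (metis (no_types, lifting))
    then show ?thesis by (simp add: c_def)
  qed
  have d_c: "d (\<Gamma> (c u)) (\<Gamma> (c v)) = d (\<Gamma> u) (\<Gamma> v)" if "u \<in> V" "v \<in> V" for u v
    using zero[of "\<Gamma> (c u)" "\<Gamma> u" "\<Gamma> (c v)"] zero[of "\<Gamma> (c v)" "\<Gamma> v" "\<Gamma> u"] that
      \<Gamma>M cV c0 commute by metis
  define S where "S = c ` V"
  define F0 where "F0 = {c ` e |e. e \<in> E \<and> (\<forall>v\<in>e. \<forall>u\<in>e. u \<noteq> v \<longrightarrow> c u \<noteq> c v)}"
  have F0E: "\<exists>u\<in>V. \<exists>v\<in>V. {u, v} \<in> E \<and> c u \<noteq> c v \<and> e = {c u, c v}" if e: "e \<in> F0" for e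
  proof -
    obtain e' where e': "e' \<in> E" "\<forall>v\<in>e'. \<forall>u\<in>e'. u \<noteq> v \<longrightarrow> c u \<noteq> c v" "e = c ` e'"
      using e unfolding F0_def by blast
    obtain u v where uv: "e' = {u, v}" "u \<in> V" "v \<in> V" "u \<noteq> v"
      using fin_graph_edgeE[OF assms(1) e'(1)] .
    have "{u, v} \<in> E" using e'(1) by (simp only: uv(1))
    moreover have "c u \<noteq> c v" using e'(2) uv(4) unfolding uv(1) by blast
    moreover have "e = {c u, c v}" using e'(3) unfolding uv(1) by simp
    ultimately show ?thesis using uv(2,3) by blast
  qed
  have fgV: "finite V" using assms(1) by (simp add: fin_graph_def)
  have fg: "fin_graph S F0"
    unfolding fin_graph_def
  proof (intro conjI ballI)
    show "finite S" using fgV by (simp add: S_def)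
    fix e assume "e \<in> F0"
    from F0E[OF this] show "\<exists>u\<in>S. \<exists>v\<in>S. u \<noteq> v \<and> e = {u, v}"
      by (auto simp: S_def)
  qed
  have conn: "graph_connected S F0"
    unfolding graph_connected_iff[OF fg]
  proof (intro conjI ballI)
    show "S \<noteq> {}" using assms(2) by (simp add: S_def graph_connected_def)
    fix a b assume "a \<in> S" "b \<in> S"
    then obtain u v where uv: "u \<in> V" "v \<in> V" "a = c u" "b = c v" by (auto simp: S_def)
    have "(c u, c v) \<in> (adj F0)\<^sup>*"
    proof (rule reach_map[OF graph_connectedD[OF assms(1,2) uv(1,2)]])
      fix x y assume xy: "{x, y} \<in> E"
      show "(c x, c y) \<in> (adj F0)\<^sup>*"
      proof (cases "c x = c y")
        case False
        then have "c ` {x, y} \<in> F0"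
          unfolding F0_def using xy by (intro CollectI exI[of _ "{x, y}"]) auto
        then show ?thesis by (intro adj_reach) simp
      qed simp
    qed
    then show "(a, b) \<in> (adj F0)\<^sup>*" by (simp add: uv)
  qed
  obtain F where F: "F \<subseteq> F0" "graph_tree S F" using spanning_tree_exists[OF fg conn] .
  show thesis
  proof (rule that[OF _ F(2)])
    show "S \<subseteq> V" using cV by (auto simp: S_def)
    show "N \<subseteq> \<Gamma> ` S"
    proof
      fix n assume n: "n \<in> N"
      then obtain v where v: "v \<in> V" "\<Gamma> v = n" using assms(4) by blast
      then have "\<exists>n\<in>N. d n (\<Gamma> v) = 0" using n refl[OF NM[OF n]] by auto
      then have "\<Gamma> (c v) \<in> N" "d (\<Gamma> (c v)) n = 0"
        using Rc[OF v(1)] v(2) by (auto simp: R_def)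
      then have "\<Gamma> (c v) = n" using assms(5) n by blast
      then show "n \<in> \<Gamma> ` S" using v(1) by (auto simp: S_def)
    qed
    show "\<forall>e\<in>F. edge_length d \<Gamma> e \<noteq> 0"
    proof
      fix e assume "e \<in> F"
      then obtain u v where "u \<in> V" "v \<in> V" "c u \<noteq> c v" "e = {c u, c v}"
        using F0E F(1) by blast
      then show "edge_length d \<Gamma> e \<noteq> 0" using c_eq by (auto simp: d_c)
    qed
    have finE: "finite E" by (rule fin_graph_finite_edges[OF assms(1)])
    have el: "edge_length d \<Gamma> (c ` e) = edge_length d \<Gamma> e" if "e \<in> E" for e
      by (rule fin_graph_edgeE[OF assms(1) that]) (simp add: d_c)
    have "network_length d F \<Gamma> \<le> (\<Sum>e\<in>(`) c ` E. edge_length d \<Gamma> e)"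
      unfolding network_length_def
    proof (rule sum_mono2)
      show "F \<subseteq> (`) c ` E" using F(1) by (auto simp: F0_def)
    qed (use finE el edge_length_nonneg[OF assms(1)] in auto)
    also have "\<dots> \<le> (\<Sum>e\<in>E. edge_length d \<Gamma> (c ` e))"
      using sum_image_le[of E "edge_length d \<Gamma>" "(`) c"] finE el edge_length_nonneg[OF assms(1)]
      by (simp add: o_def)
    also have "\<dots> = network_length d E \<Gamma>"
      unfolding network_length_def by (rule sum.cong) (simp_all add: el)
    finally show "network_length d F \<Gamma> \<le> network_length d E \<Gamma>" .
  qed
qed

lemma network_le_walk:
  assumes "walk E (edge_length d \<Gamma>) u v w" "fin_graph V E" "\<Gamma> ` V \<subseteq> M" "v \<in> V"
  shows "d (\<Gamma> u) (\<Gamma> v) \<le> w"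
  using assms(1,4)
proof (induction rule: walk.induct)
  case (walk_refl u)
  then have "\<Gamma> u \<in> M" using assms(3) by blast
  then show ?case by (simp add: refl)
next
  case (walk_step u v z w)
  have "u \<in> V" "v \<in> V" using fin_graph_edgeD[OF assms(2) walk_step(1)] by auto
  then have "d (\<Gamma> u) (\<Gamma> z) \<le> d (\<Gamma> u) (\<Gamma> v) + d (\<Gamma> v) (\<Gamma> z)"
    using assms(3) walk_step(4) by (intro triangle) auto
  also have "d (\<Gamma> v) (\<Gamma> z) \<le> w" using walk_step by blast
  finally show ?case by simp
qed

end

section \<open>Fillings\<close>

lemma walk_nonneg: "walk E \<omega> u v w \<Longrightarrow> (\<And>e. e \<in> E \<Longrightarrow> 0 \<le> \<omega> e) \<Longrightarrow> 0 \<le> w"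
  by (induction rule: walk.induct) (auto intro: add_nonneg_nonneg)

lemma weight_dist_le_walk:
  assumes "walk E \<omega> u v w" "fin_graph V E" "v \<in> V" "\<And>e. e \<in> E \<Longrightarrow> 0 \<le> \<omega> e"
  shows "weight_dist V E \<omega> u v \<le> w"
proof -
  obtain p where p: "p \<in> graph_paths V E u v" "path_weight \<omega> p \<le> w"
    using walk_to_path[OF assms] by blast
  have "weight_dist V E \<omega> u v \<le> path_weight \<omega> p"
    unfolding weight_dist_def
    using p(1) assms(2) by (intro Min_le finite_imageI finite_graph_paths) (auto simp: fin_graph_def)
  with p(2) show ?thesis by linarith
qed

lemma walk_weight_dist:
  assumes "fin_graph V E" "graph_connected V E" "u \<in> V" "v \<in> V"
  shows "walk E \<omega> u v (weight_dist V E \<omega> u v)"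
proof -
  have "weight_dist V E \<omega> u v \<in> path_weight \<omega> ` graph_paths V E u v"
    unfolding weight_dist_def
    using assms by (intro Min_in finite_imageI finite_graph_paths)
      (auto simp: fin_graph_def graph_connected_def)
  then obtain p where "p \<in> graph_paths V E u v" "weight_dist V E \<omega> u v = path_weight \<omega> p" by blast
  then show ?thesis using path_walk[of p E \<omega>] by (auto simp: graph_paths_def)
qed

text \<open>Walks may replace paths in the definition of a filling.\<close>

lemma filling_iff_walks:
  "filling M \<rho> V E \<omega> \<longleftrightarrow> graph_joins V E M \<and> (\<forall>e\<in>E. 0 \<le> \<omega> e) \<and>
     (\<forall>p\<in>M. \<forall>q\<in>M. \<forall>w. walk E \<omega> (Inl p) (Inl q) w \<longrightarrow> \<rho> p q \<le> w)"
proof (cases "graph_joins V E M \<and> (\<forall>e\<in>E. 0 \<le> \<omega> e)")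
  case True
  then have g: "fin_graph V E" "graph_connected V E" "Inl ` M \<subseteq> V" "\<And>e. e \<in> E \<Longrightarrow> 0 \<le> \<omega> e"
    by (auto simp: graph_joins_def)
  have "\<rho> p q \<le> weight_dist V E \<omega> (Inl p) (Inl q) \<longleftrightarrow>
      (\<forall>w. walk E \<omega> (Inl p) (Inl q) w \<longrightarrow> \<rho> p q \<le> w)" if "p \<in> M" "q \<in> M" for p q
  proof -
    have "Inl p \<in> V" "Inl q \<in> V" using that g(3) by auto
    then have "walk E \<omega> (Inl p) (Inl q) (weight_dist V E \<omega> (Inl p) (Inl q))"
      "\<And>w. walk E \<omega> (Inl p) (Inl q) w \<Longrightarrow> weight_dist V E \<omega> (Inl p) (Inl q) \<le> w"
      using walk_weight_dist[OF g(1,2)] weight_dist_le_walk[OF _ g(1) _ g(4)] by simp_all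
    then show ?thesis by (meson order_trans)
  qed
  with True show ?thesis by (auto simp: filling_def)
qed (auto simp: filling_def)

lemma fillingD:
  assumes "filling M \<rho> V E \<omega>"
  shows "fin_graph V E" "graph_connected V E" "Inl ` M \<subseteq> V" "finite E"
    "\<And>e. e \<in> E \<Longrightarrow> 0 \<le> \<omega> e" "0 \<le> sum \<omega> E"
  using assms fin_graph_finite_edges by (auto simp: filling_def graph_joins_def intro: sum_nonneg)

lemma mf_le: "filling M \<rho> V E \<omega> \<Longrightarrow> mf M \<rho> \<le> sum \<omega> E"
  unfolding mf_def by (rule cInf_lower) (auto intro!: bdd_belowI[of _ 0] fillingD(6))

lemma minimal_fillingI:
  assumes "filling M \<rho> V E \<omega>" "\<And>V' E' \<omega>'. filling M \<rho> V' E' \<omega>' \<Longrightarrow> sum \<omega> E \<le> sum \<omega>' E'"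
  shows "minimal_filling M \<rho> V E \<omega>"
  unfolding minimal_filling_def mf_def
  using assms by (auto intro!: cInf_eq_minimum[symmetric])

lemma walk_cong: "walk E \<omega> u v w \<Longrightarrow> (\<And>e. e \<in> E \<Longrightarrow> \<omega> e = \<omega>' e) \<Longrightarrow> walk E \<omega>' u v w"
  by (induction rule: walk.induct) (auto intro: walk.intros)

lemma filling_cong:
  assumes "filling M \<rho> V E \<omega>" "\<And>e. e \<in> E \<Longrightarrow> \<omega> e = \<omega>' e"
  shows "filling M \<rho> V E \<omega>'"
  using assms walk_cong[of E \<omega>' _ _ _ \<omega>] unfolding filling_iff_walks by (metis (no_types))

lemma (in Pseudometric_space) filling_of_network:
  assumes "graph_joins V E P" "\<Gamma> ` V \<subseteq> M"
    and "\<And>p q. p \<in> P \<Longrightarrow> q \<in> P \<Longrightarrow> \<rho> p q \<le> d (\<Gamma> (Inl p)) (\<Gamma> (Inl q))"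
  shows "filling P \<rho> V E (edge_length d \<Gamma>)"
proof -
  have g: "fin_graph V E" "Inl ` P \<subseteq> V" using assms(1) by (auto simp: graph_joins_def)
  have "\<rho> p q \<le> w" if "p \<in> P" "q \<in> P" "walk E (edge_length d \<Gamma>) (Inl p) (Inl q) w" for p q w
    using network_le_walk[OF that(3) g(1) assms(2)] assms(3)[OF that(1,2)] that(2) g(2) by auto
  then show ?thesis
    using assms(1) edge_length_nonneg[OF g(1)] by (auto simp: filling_iff_walks)
qed

text \<open>The distance \<open>d\<^sub>\<omega>\<close>, extended by \<open>0\<close> outside the graph because the axioms of
  a pseudo-metric require non-negativity and symmetry everywhere.\<close>

definition graph_dist :: "'v set \<Rightarrow> 'v set set \<Rightarrow> ('v set \<Rightarrow> real) \<Rightarrow> 'v \<Rightarrow> 'v \<Rightarrow> real" where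
  "graph_dist V E \<omega> u v = (if u \<in> V \<and> v \<in> V then weight_dist V E \<omega> u v else 0)"

lemma Pseudometric_space_graph_dist:
  assumes "fin_graph V E" "graph_connected V E" "\<And>e. e \<in> E \<Longrightarrow> 0 \<le> \<omega> e"
  shows "Pseudometric_space V (graph_dist V E \<omega>)"
proof
  note wd = walk_weight_dist[OF assms(1,2)] and le = weight_dist_le_walk[OF _ assms(1) _ assms(3)]
  show "0 \<le> graph_dist V E \<omega> x y" for x y
    using walk_nonneg[OF wd assms(3)] by (auto simp: graph_dist_def)
  show "graph_dist V E \<omega> x y = graph_dist V E \<omega> y x" for x y
    using le[OF walk_sym[OF wd]] by (auto simp: graph_dist_def intro: antisym)
  show "graph_dist V E \<omega> x x = 0" if "x \<in> V" for x
    using le[OF walk_refl that] walk_nonneg[OF wd[OF that that] assms(3)] that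
    by (auto simp: graph_dist_def intro: antisym)
  show "graph_dist V E \<omega> x z \<le> graph_dist V E \<omega> x y + graph_dist V E \<omega> y z"
    if "x \<in> V" "y \<in> V" "z \<in> V" for x y z
    using le[OF walk_trans[OF wd[OF that(1,2)] wd[OF that(2,3)]] that(3)] that
    by (simp add: graph_dist_def)
qed

lemma graph_dist_edge_le:
  assumes "fin_graph V E" "\<And>e. e \<in> E \<Longrightarrow> 0 \<le> \<omega> e" "{u, v} \<in> E"
  shows "graph_dist V E \<omega> u v \<le> \<omega> {u, v}"
proof -
  have "walk E \<omega> u v (\<omega> {u, v})" using walk_step[OF assms(3) walk_refl, of \<omega>] by simp
  then show ?thesis
    using weight_dist_le_walk[OF _ assms(1) _ assms(2)] fin_graph_edgeD[OF assms(1,3)]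
    by (auto simp: graph_dist_def)
qed

lemma network_length_graph_dist_le:
  assumes "fin_graph V E" "graph_connected V E" "\<And>e. e \<in> E \<Longrightarrow> 0 \<le> \<omega> e"
  shows "network_length (graph_dist V E \<omega>) E (\<lambda>v. v) \<le> sum \<omega> E"
  unfolding network_length_def
proof (rule sum_mono)
  interpret Pseudometric_space V "graph_dist V E \<omega>"
    by (rule Pseudometric_space_graph_dist[OF assms])
  fix e assume e: "e \<in> E"
  obtain u v where "e = {u, v}" using fin_graph_edgeE[OF assms(1) e] .
  then show "edge_length (graph_dist V E \<omega>) (\<lambda>v. v) e \<le> \<omega> e"
    using graph_dist_edge_le[OF assms(1,3)] e by simp
qed

lemma filling_le_graph_dist:
  assumes "filling M \<rho> V E \<omega>" "p \<in> M" "q \<in> M"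
  shows "\<rho> p q \<le> graph_dist V E \<omega> (Inl p) (Inl q)"
  using assms by (auto simp: filling_def graph_joins_def graph_dist_def)

lemma binary_tree_filling:
  assumes "filling M \<rho> V E \<omega>" "finite M" "2 \<le> card M"
  obtains V' E' \<omega>' where "V' \<subseteq> Inl ` M \<union> Inr ` {..<card M}" "binary_tree V' E' (Inl ` M)"
    "filling M \<rho> V' E' \<omega>'" "sum \<omega>' E' \<le> sum \<omega> E"
proof -
  let ?d = "graph_dist V E \<omega>"
  note g = fillingD[OF assms(1)]
  interpret Pseudometric_space V ?d
    by (rule Pseudometric_space_graph_dist[OF g(1,2,5)])
  have c: "card (Inl ` M :: ('a + nat) set) = card M" "card (Inr ` {..<card M} :: ('a + nat) set) = card M"
    by (simp_all add: card_image)
  have "finite (Inr ` {..<card M} :: ('a + nat) set)"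
    "(\<lambda>v. v) ` Inl ` M \<inter> (Inr ` {..<card M} :: ('a + nat) set) = {}" by auto
  then obtain V' E' \<Gamma>' where *: "binary_tree V' E' ((\<lambda>v. v) ` Inl ` M)"
    "V' \<subseteq> (\<lambda>v. v) ` Inl ` M \<union> Inr ` {..<card M}" "\<Gamma>' ` V' \<subseteq> V"
    "\<forall>n\<in>Inl ` M. \<Gamma>' n = n" "network_length ?d E' \<Gamma>' \<le> network_length ?d E (\<lambda>v. v)"
    using binary_tree_of_network[OF g(1,2), of "\<lambda>v. v" "Inl ` M" "\<lambda>v. v" "Inr ` {..<card M}",
        unfolded c] g(3) assms(3) by (metis image_ident inj_on_id2 order_refl)
  have "graph_joins V' E' M"
    using *(1) by (auto simp: binary_tree_def graph_joins_def graph_tree_def)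
  then have "filling M \<rho> V' E' (edge_length ?d \<Gamma>')"
    using *(3,4) filling_le_graph_dist[OF assms(1)] by (intro filling_of_network) auto
  moreover have "sum (edge_length ?d \<Gamma>') E' \<le> sum \<omega> E"
    using order_trans[OF *(5) network_length_graph_dist_le[OF g(1,2,5)]]
    by (simp add: network_length_def)
  ultimately show thesis using that *(1,2) by simp
qed

lemma continuous_on_path_weight:
  "continuous_on UNIV (\<lambda>\<omega>. path_weight \<omega> p)"
  by (induction p rule: induct_list012) (auto simp: path_weight_def intro!: continuous_intros)

text \<open>On a fixed graph the minimum is attained: weights bounded by the total weight of a given filling
  lie in a product of compact intervals, and being a filling is a closed condition on them.\<close>

lemma minimal_weight_on_graph:
  assumes "finite M" "filling M \<rho> V E \<omega>0"
  obtains \<omega> where "filling M \<rho> V E \<omega>" "\<And>\<omega>'. filling M \<rho> V E \<omega>' \<Longrightarrow> sum \<omega> E \<le> sum \<omega>' E"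
proof -
  note g = fillingD[OF assms(2)]
  let ?paths = "\<lambda>p q. graph_paths V E (Inl p) (Inl q)"
  define B where "B = (PiE UNIV (\<lambda>_. {0..sum \<omega>0 E}) :: (('a + nat) set \<Rightarrow> real) set)"
  define K where "K = B \<inter> (\<Inter>p\<in>M. \<Inter>q\<in>M. \<Inter>\<pi>\<in>?paths p q. {\<omega>. \<rho> p q \<le> path_weight \<omega> \<pi>})"
  have "compactin (product_topology (\<lambda>_. euclidean) UNIV) B"
    unfolding B_def compactin_PiE by simp
  then have "compact B" by (simp add: euclidean_product_topology)
  then have "compact K"
    unfolding K_def
    by (intro compact_Int_closed closed_INT ballI closed_Collect_le continuous_on_const
        continuous_on_path_weight)
  have Min_iff: "\<rho> p q \<le> weight_dist V E \<omega> (Inl p) (Inl q) \<longleftrightarrow> (\<forall>\<pi>\<in>?paths p q. \<rho> p q \<le> path_weight \<omega> \<pi>)"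
    if "p \<in> M" "q \<in> M" for p q \<omega>
    unfolding weight_dist_def
  proof (subst Min_ge_iff)
    show "finite (path_weight \<omega> ` ?paths p q)"
      using g(1) by (intro finite_imageI finite_graph_paths) (simp add: fin_graph_def)
    show "path_weight \<omega> ` ?paths p q \<noteq> {}"
      using g(2,3) that by (simp add: graph_connected_def image_subset_iff)
  qed simp
  have K_filling: "filling M \<rho> V E \<omega>" if "\<omega> \<in> K" for \<omega>
    using that Min_iff assms(2) unfolding filling_def K_def B_def by (auto simp: PiE_iff)
  \<comment> \<open>weights off \<open>E\<close> are irrelevant and are set to \<open>0\<close> to land in the product\<close>
  have filling_K: "(\<lambda>e. if e \<in> E then \<omega> e else 0) \<in> K"
    if f: "filling M \<rho> V E \<omega>" "sum \<omega> E \<le> sum \<omega>0 E" for \<omega>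
  proof -
    have "filling M \<rho> V E (\<lambda>e. if e \<in> E then \<omega> e else 0)"
      by (rule filling_cong[OF f(1)]) simp
    moreover have "\<omega> e \<le> sum \<omega>0 E" if "e \<in> E" for e
      using member_le_sum[of e E \<omega>] fillingD(4,5)[OF f(1)] that f(2) by force
    ultimately show ?thesis
      using Min_iff fillingD(5)[OF f(1)] g(6) unfolding filling_def K_def B_def by (auto simp: PiE_iff)
  qed
  have "K \<noteq> {}" using filling_K[OF assms(2)] by blast
  moreover have "continuous_on K (\<lambda>\<omega>. sum \<omega> E)"
    by (intro continuous_on_sum continuous_on_subset[OF continuous_on_product_coordinates]) simp
  ultimately obtain \<omega> where \<omega>: "\<omega> \<in> K" "\<And>\<omega>'. \<omega>' \<in> K \<Longrightarrow> sum \<omega> E \<le> sum \<omega>' E"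
    using continuous_attains_inf[OF \<open>compact K\<close>] by blast
  have small: "sum \<omega> E \<le> sum \<omega>' E" if "filling M \<rho> V E \<omega>'" "sum \<omega>' E \<le> sum \<omega>0 E" for \<omega>'
    using \<omega>(2)[OF filling_K[OF that]] by simp
  show thesis
  proof (rule that[OF K_filling[OF \<omega>(1)]])
    show "sum \<omega> E \<le> sum \<omega>' E" if "filling M \<rho> V E \<omega>'" for \<omega>'
      using small[OF that] small[OF assms(2)] by linarith
  qed
qed

lemma minimal_binary_tree_filling:
  assumes "Pseudometric_space M \<rho>" "finite M" "2 \<le> card M"
  shows "\<exists>V E \<omega>. minimal_filling M \<rho> V E \<omega> \<and> binary_tree V E (Inl ` M)"
proof -
  interpret Pseudometric_space M \<rho> by fact
  define U where "U = (Inl ` M \<union> Inr ` {..<card M} :: ('a + nat) set)"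
  define C where "C = {g. fst g \<subseteq> U \<and> binary_tree (fst g) (snd g) (Inl ` M) \<and>
    (\<exists>\<omega>. filling M \<rho> (fst g) (snd g) \<omega>)}"
  have "C \<subseteq> Pow U \<times> Pow (Pow U)"
    unfolding C_def by (fastforce simp: binary_tree_def graph_tree_def fin_graph_def)
  moreover have "finite U" using assms(2) by (simp add: U_def)
  ultimately have "finite C" by (metis finite_Pow_iff finite_SigmaI finite_subset)
  have reduce: "\<exists>g\<in>C. \<exists>\<omega>'. filling M \<rho> (fst g) (snd g) \<omega>' \<and> sum \<omega>' (snd g) \<le> sum \<omega> E"
    if fill: "filling M \<rho> V E \<omega>" for V E \<omega>
  proof -
    obtain V' E' \<omega>' where "V' \<subseteq> U" "binary_tree V' E' (Inl ` M)"
      "filling M \<rho> V' E' \<omega>'" "sum \<omega>' E' \<le> sum \<omega> E"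
      using binary_tree_filling[OF fill assms(2,3)] unfolding U_def .
    then show ?thesis by (intro bexI[of _ "(V', E')"] exI[of _ \<omega>']) (auto simp: C_def)
  qed
  have "C \<noteq> {}"
  proof -
    \<comment> \<open>the complete graph on \<open>M\<close>, weighted by \<open>\<rho>\<close>, is a filling\<close>
    define K :: "('a + nat) set set" where
      "K = {{u, v} |u v. u \<in> Inl ` M \<and> v \<in> Inl ` M \<and> u \<noteq> v}"
    have fg: "fin_graph (Inl ` M :: ('a + nat) set) K"
      unfolding fin_graph_def K_def using assms(2) by blast
    have "M \<noteq> {}" using assms(3) by auto
    have "(u, v) \<in> (adj K)\<^sup>*" if "u \<in> Inl ` M" "v \<in> Inl ` M" for u v :: "'a + nat"
    proof (cases "u = v")
      case False
      then have "{u, v} \<in> K" using that unfolding K_def by blast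
      then show ?thesis by (rule adj_reach)
    qed simp
    then have "graph_joins (Inl ` M) K M"
      using fg \<open>M \<noteq> {}\<close> unfolding graph_joins_def graph_connected_iff[OF fg] by simp
    then have "filling M \<rho> (Inl ` M) K (edge_length \<rho> projl)"
      by (rule filling_of_network) auto
    then show ?thesis using reduce by blast
  qed
  have "\<forall>g\<in>C. \<exists>\<omega>. filling M \<rho> (fst g) (snd g) \<omega> \<and>
      (\<forall>\<omega>'. filling M \<rho> (fst g) (snd g) \<omega>' \<longrightarrow> sum \<omega> (snd g) \<le> sum \<omega>' (snd g))"
  proof
    fix g assume "g \<in> C"
    then obtain \<omega>0 where "filling M \<rho> (fst g) (snd g) \<omega>0" by (auto simp: C_def)
    from minimal_weight_on_graph[OF assms(2) this]
    show "\<exists>\<omega>. filling M \<rho> (fst g) (snd g) \<omega> \<and>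
      (\<forall>\<omega>'. filling M \<rho> (fst g) (snd g) \<omega>' \<longrightarrow> sum \<omega> (snd g) \<le> sum \<omega>' (snd g))" by metis
  qed
  from bchoice[OF this] obtain W where
    W: "\<And>g. g \<in> C \<Longrightarrow> filling M \<rho> (fst g) (snd g) (W g)"
      "\<And>g \<omega>'. g \<in> C \<Longrightarrow> filling M \<rho> (fst g) (snd g) \<omega>' \<Longrightarrow> sum (W g) (snd g) \<le> sum \<omega>' (snd g)"
    by metis
  define g0 where "g0 = arg_min_on (\<lambda>g. sum (W g) (snd g)) C"
  have g0: "g0 \<in> C" "\<And>g. g \<in> C \<Longrightarrow> sum (W g0) (snd g0) \<le> sum (W g) (snd g)"
    unfolding g0_def
    by (rule arg_min_if_finite(1)[OF \<open>finite C\<close> \<open>C \<noteq> {}\<close>])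
      (rule arg_min_least[OF \<open>finite C\<close> \<open>C \<noteq> {}\<close>])
  have "minimal_filling M \<rho> (fst g0) (snd g0) (W g0)"
  proof (rule minimal_fillingI[OF W(1)[OF g0(1)]])
    fix V E \<omega> assume "filling M \<rho> V E \<omega>"
    then obtain g \<omega>' where "g \<in> C" "filling M \<rho> (fst g) (snd g) \<omega>'" "sum \<omega>' (snd g) \<le> sum \<omega> E"
      using reduce by blast
    then show "sum (W g0) (snd g0) \<le> sum \<omega> E"
      using g0(2) W(2) by (meson order_trans)
  qed
  moreover have "binary_tree (fst g0) (snd g0) (Inl ` M)" using g0(1) by (simp add: C_def)
  ultimately show ?thesis by blast
qed

lemma nondegenerate_tree_filling:
  assumes "filling M \<rho> V E \<omega>" "Metric_space M \<rho>"
  obtains S F \<omega>' where "filling M \<rho> S F \<omega>'" "graph_tree S F" "nondegenerate_weight F \<omega>'"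
    "sum \<omega>' F \<le> sum \<omega> E"
proof -
  let ?d = "graph_dist V E \<omega>"
  note g = fillingD[OF assms(1)]
  interpret Pseudometric_space V ?d
    by (rule Pseudometric_space_graph_dist[OF g(1,2,5)])
  have le: "\<rho> p q \<le> ?d (Inl p) (Inl q)" if "p \<in> M" "q \<in> M" for p q
    using filling_le_graph_dist[OF assms(1) that] .
  have pos: "?d x y \<noteq> 0" if xy: "x \<in> Inl ` M" "y \<in> Inl ` M" "x \<noteq> y" for x y
  proof -
    obtain p q where "p \<in> M" "q \<in> M" "x = Inl p" "y = Inl q" "p \<noteq> q" using xy by blast
    moreover from this have "0 < \<rho> p q"
      using assms(2) by (simp add: Metric_space.mdist_pos_less)
    ultimately show ?thesis using le[of p q] by auto
  qed
  obtain S F where *: "S \<subseteq> V" "graph_tree S F" "Inl ` M \<subseteq> (\<lambda>v. v) ` S"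
    "network_length ?d F (\<lambda>v. v) \<le> network_length ?d E (\<lambda>v. v)"
    "\<forall>e\<in>F. edge_length ?d (\<lambda>v. v) e \<noteq> 0"
    by (rule nondegenerate_tree_of_network[OF g(1,2), of "\<lambda>v. v" "Inl ` M"]) (use g(3) pos in auto)
  have "graph_joins S F M" using *(2,3) by (simp add: graph_joins_def graph_tree_def)
  then have "filling M \<rho> S F (edge_length ?d (\<lambda>v. v))"
    using *(1) le by (intro filling_of_network) auto
  moreover have "sum (edge_length ?d (\<lambda>v. v)) F \<le> sum \<omega> E"
    using order_trans[OF *(4) network_length_graph_dist_le[OF g(1,2,5)]]
    by (simp add: network_length_def)
  ultimately show thesis
    using that *(2,5) by (simp add: nondegenerate_weight_def)
qed

text \<open>A space with at most one point is filled by a single vertex.\<close>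

lemma minimal_filling_small:
  assumes "Pseudometric_space M \<rho>" "finite M" "card M < 2"
  shows "\<exists>V E \<omega>. minimal_filling M \<rho> V E \<omega>"
proof -
  interpret Pseudometric_space M \<rho> by fact
  have "card M = 0 \<or> card M = 1" using assms(3) by linarith
  then obtain v :: "'a + nat" where v: "Inl ` M \<subseteq> {v}"
    using assms(2) by (auto simp: card_1_singleton_iff)
  have "p = q \<and> w = 0" if "p \<in> M" "q \<in> M" "walk {} (\<lambda>_. 0) (Inl p :: 'a + nat) (Inl q) w" for p q w
    using that(3) by (cases rule: walk.cases) auto
  then have "\<rho> p q \<le> w" if "p \<in> M" "q \<in> M" "walk {} (\<lambda>_. 0) (Inl p :: 'a + nat) (Inl q) w" for p q w
    using that refl by force
  then have "filling M \<rho> {v} {} (\<lambda>_. 0)"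
    using v single_vertex_graph(1,2)[of v] by (simp add: filling_iff_walks graph_joins_def)
  then have "minimal_filling M \<rho> {v} {} (\<lambda>_. 0)"
    by (rule minimal_fillingI) (simp add: fillingD(6))
  then show ?thesis by blast
qed

text \<open>Whenever a walk uses the new edge it is at a point of \<open>M\<close>, so it falls into stretches between
  points of \<open>M\<close> inside the old graph. The induction reads the walk from its end and compares with the
  distance in the old graph from an arbitrary point of \<open>M\<close>.\<close>

lemma filling_add_null_edge:
  assumes "Pseudometric_space M \<rho>" "filling M \<rho> V E \<omega>" "p \<in> M" "q \<in> M" "\<rho> p q = 0"
    and "fin_graph V E'" "graph_connected V E'" "E' \<subseteq> insert {Inl p, Inl q} E"
  shows "filling M \<rho> V E' (\<omega>({Inl p, Inl q} := 0))"
proof -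
  interpret Pseudometric_space M \<rho> by fact
  let ?d = "weight_dist V E \<omega>" and ?\<omega> = "\<omega>({Inl p, Inl q} := 0)"
  note g = fillingD[OF assms(2)]
  note wd = walk_weight_dist[OF g(1,2)] and le = weight_dist_le_walk[where \<omega> = \<omega>, OF _ g(1) _ g(5)]
  have V: "Inl a \<in> V" if "a \<in> M" for a using that g(3) by blast
  have fill: "\<rho> a b \<le> ?d (Inl a) (Inl b)" if "a \<in> M" "b \<in> M" for a b
    using assms(2) that by (simp add: filling_def)
  have jump: "\<rho> a b \<le> ?d (Inl a) (Inl x) + w"
    if "a \<in> M" "b \<in> M" "x \<in> M" "y \<in> M" "\<rho> x y = 0" "\<rho> y b \<le> ?d (Inl y) (Inl y) + w" for a b x y w
  proof -
    have "?d (Inl y) (Inl y) \<le> 0" using le[OF walk_refl] V that(4) by blast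
    then show ?thesis
      using triangle[of a x b] triangle[of x y b] fill[of a x] that by linarith
  qed
  have key: "\<forall>a\<in>M. \<rho> a b \<le> ?d (Inl a) u + w"
    if "walk E' ?\<omega> u (Inl b) w" "b \<in> M" for u b w
    using that
  proof (induction u "Inl b :: 'a + nat" w rule: walk.induct)
    case walk_refl
    then show ?case using fill by simp
  next
    case (walk_step u v w)
    have uv: "u \<in> V" "v \<in> V" using fin_graph_edgeD[OF assms(6) walk_step(1)] by auto
    show ?case
    proof
      fix a assume a: "a \<in> M"
      show "\<rho> a b \<le> ?d (Inl a) u + (?\<omega> {u, v} + w)"
      proof (cases "{u, v} = {Inl p, Inl q}")
        case True
        then have "?\<omega> {u, v} = 0" by simp
        moreover obtain x y where xy: "x \<in> M" "y \<in> M" "u = Inl x" "v = Inl y" "\<rho> x y = 0"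
          using True assms(3-5) commute[of p q] by (auto simp: doubleton_eq_iff)
        moreover have "\<rho> y b \<le> ?d (Inl y) (Inl y) + w" using walk_step xy by blast
        ultimately show ?thesis using jump[OF a walk_step(4) xy(1,2,5)] by simp
      next
        case False
        then have "{u, v} \<in> E" using walk_step(1) assms(8) by blast
        then have "walk E \<omega> u v (\<omega> {u, v})" using walk.walk_step[OF _ walk.walk_refl, of u v E \<omega>] by simp
        then have "?d (Inl a) v \<le> ?d (Inl a) u + \<omega> {u, v}"
          using le[OF walk_trans[OF wd[OF V[OF a] uv(1)]] uv(2)] by blast
        moreover have "\<rho> a b \<le> ?d (Inl a) v + w" using walk_step a by blast
        ultimately show ?thesis using False by simp
      qed
    qed
  qed
  have "\<rho> a b \<le> w" if "a \<in> M" "b \<in> M" "walk E' ?\<omega> (Inl a) (Inl b) w" for a b w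
  proof -
    have "?d (Inl a) (Inl a) \<le> 0" using le[OF walk_refl] V that(1) by blast
    then show ?thesis using key[OF that(3,2)] that(1) by force
  qed
  moreover have "0 \<le> ?\<omega> e" if "e \<in> E'" for e
    using that assms(8) g(5) by auto
  ultimately show ?thesis
    using assms(6,7) g(3) by (simp add: filling_iff_walks graph_joins_def)
qed

lemma metric_if_nondegenerate_minimal_filling:
  assumes "Pseudometric_space M \<rho>" "minimal_filling M \<rho> V E \<omega>" "nondegenerate_weight E \<omega>"
  shows "Metric_space M \<rho>"
  unfolding Metric_space_iff_Pseudometric_space
proof (intro conjI ballI impI notI)
  show "Pseudometric_space M \<rho>" by fact
  fix p q assume pq: "p \<in> M" "q \<in> M" "p \<noteq> q" "\<rho> p q = 0"
  have fill: "filling M \<rho> V E \<omega>" and min: "sum \<omega> E = mf M \<rho>"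
    using assms(2) by (auto simp: minimal_filling_def)
  note g = fillingD[OF fill]
  have pos: "0 < \<omega> e" if "e \<in> E" for e
    using assms(3) g(5)[OF that] that by (force simp: nondegenerate_weight_def)
  let ?pq = "{Inl p, Inl q} :: ('a + nat) set"
  let ?\<omega> = "\<omega>(?pq := 0)"
  \<comment> \<open>if \<open>p\<close> and \<open>q\<close> are already adjacent, their edge itself is made degenerate\<close>
  obtain e where e: "e \<in> E" "fin_graph V (insert ?pq (E - {e}))"
    "graph_connected V (insert ?pq (E - {e}))"
  proof (cases "?pq \<in> E")
    case True
    then show thesis using that[of ?pq] g(1,2) by (simp add: insert_absorb)
  next
    case False
    then show thesis using exchange_edge[OF g(1,2) _ _ _ False] g(3) pq that by blast
  qed
  have "filling M \<rho> V (insert ?pq (E - {e})) ?\<omega>"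
    by (rule filling_add_null_edge[OF assms(1) fill pq(1,2,4) e(2,3)]) auto
  from mf_le[OF this] have "mf M \<rho> \<le> sum ?\<omega> (insert ?pq (E - {e}))" .
  also have "\<dots> = sum ?\<omega> (E - {e} - {?pq})"
    using g(4) by (simp add: sum.insert_remove)
  also have "\<dots> = sum \<omega> (E - {e} - {?pq})" by (intro sum.cong) auto
  also have "\<dots> \<le> sum \<omega> (E - {e})"
    using g(4,5) by (intro sum_mono2) auto
  also have "\<dots> < sum \<omega> E"
    using sum.remove[OF g(4) e(1), of \<omega>] pos[OF e(1)] by simp
  finally show False using min by simp
qed

section \<open>Shortest networks\<close>

context Pseudometric_space
begin

lemma smt_le:
  assumes "network_joins M N V E B \<Gamma>"
  shows "smt M d N \<le> network_length d E \<Gamma>"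
  unfolding smt_def
proof (rule cInf_lower)
  show "bdd_below {network_length d E \<Gamma> |V E B \<Gamma>. network_joins M N V E B \<Gamma>}"
    by (rule bdd_belowI[of _ 0])
      (auto simp: network_joins_def network_def intro: network_length_nonneg)
qed (use assms in blast)

lemma shortest_networkI:
  assumes "shortest_network M d N V E B \<Gamma>" "network_joins M N V' E' B' \<Gamma>'"
    and "network_length d E' \<Gamma>' \<le> network_length d E \<Gamma>"
  shows "shortest_network M d N V' E' B' \<Gamma>'"
  using assms smt_le[OF assms(2)] by (simp add: shortest_network_def)

lemma shortest_networkD:
  assumes "shortest_network M d N V E B \<Gamma>"
  shows "fin_graph V E" "graph_connected V E" "\<Gamma> ` V \<subseteq> M" "N \<subseteq> \<Gamma> ` V" "B \<subseteq> V" "\<Gamma> ` B = N"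
  using assms by (auto simp: shortest_network_def network_joins_def network_def)

lemma shortest_binary_tree_exists:
  assumes "shortest_network M d N V E B \<Gamma>" "finite N" "N \<noteq> {}"
  shows "\<exists>V E B \<Gamma>. shortest_binary_tree M d N V E B \<Gamma>"
proof -
  note g = shortest_networkD[OF assms(1)]
  have "\<exists>V' E' B' \<Gamma>'. binary_tree V' E' B' \<and> network_joins M N V' E' B' \<Gamma>' \<and>
      network_length d E' \<Gamma>' \<le> network_length d E \<Gamma>"
  proof (cases "card N = 1")
    case True
    \<comment> \<open>both leaves of a single edge are sent to the only point\<close>
    then obtain n where n: "N = {n}" by (auto simp: card_1_singleton_iff)
    have "n \<in> M" using g(3,4) n by blast
    have bt: "binary_tree {0, 1} {{0, 1::nat}} {0, 1}"
      using planted_binary_tree[OF rbt_leaf, of 0 "1::nat"] by simp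
    then have "fin_graph {0, 1} {{0, 1::nat}}" "graph_connected {0, 1} {{0, 1::nat}}"
      by (auto simp: binary_tree_def graph_tree_def)
    then have "network_joins M N {0, 1} {{0, 1}} {0, 1} (\<lambda>_. n)"
      using n \<open>n \<in> M\<close> by (simp add: network_joins_def network_def)
    moreover have "network_length d {{0, 1}} (\<lambda>_::nat. n) \<le> network_length d E \<Gamma>"
      using network_length_nonneg[OF g(1), of \<Gamma>] refl[OF \<open>n \<in> M\<close>] by (simp add: network_length_def)
    ultimately show ?thesis using bt by blast
  next
    case False
    moreover have "card N \<noteq> 0" using assms(2,3) by simp
    ultimately have c: "2 \<le> card N" by linarith
    obtain lab where lab: "bij_betw lab N {..<card N}"
      using ex_bij_betw_finite_nat[OF assms(2)] by (auto simp: lessThan_atLeast0)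
    let ?I = "{card N..<card N + card N}"
    have I: "inj_on lab N" "finite ?I" "lab ` N \<inter> ?I = {}" "card N \<le> card ?I"
      using lab by (auto simp: bij_betw_def)
    obtain V' E' \<Gamma>' where *: "binary_tree V' E' (lab ` N)" "V' \<subseteq> lab ` N \<union> ?I" "\<Gamma>' ` V' \<subseteq> M"
      "\<forall>n\<in>N. \<Gamma>' (lab n) = n" "network_length d E' \<Gamma>' \<le> network_length d E \<Gamma>"
      using binary_tree_of_network[OF g(1-4) c I] .
    have "lab ` N \<subseteq> V'" "fin_graph V' E'" "graph_connected V' E'"
      using *(1) by (auto simp: binary_tree_def graph_tree_def)
    moreover have "\<Gamma>' ` lab ` N = N" using *(4) by force
    ultimately have "network_joins M N V' E' (lab ` N) \<Gamma>'"
      using *(3) unfolding network_joins_def network_def by (metis image_mono)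
    with *(1,5) show ?thesis by blast
  qed
  then show ?thesis
    using shortest_networkI[OF assms(1)] unfolding shortest_binary_tree_def by blast
qed

lemma shortest_nondegenerate_tree_exists:
  assumes "shortest_network M d N V E B \<Gamma>"
    and "\<And>x y. x \<in> N \<Longrightarrow> y \<in> N \<Longrightarrow> x \<noteq> y \<Longrightarrow> d x y \<noteq> 0"
  shows "\<exists>V E B \<Gamma>. shortest_nondegenerate_tree M d N V E B \<Gamma>"
proof -
  note g = shortest_networkD[OF assms(1)]
  obtain S F where *: "S \<subseteq> V" "graph_tree S F" "N \<subseteq> \<Gamma> ` S"
    "network_length d F \<Gamma> \<le> network_length d E \<Gamma>" "\<forall>e\<in>F. edge_length d \<Gamma> e \<noteq> 0"
    using nondegenerate_tree_of_network[OF g(1-4) assms(2)] .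
  have "network_joins M N S F {v \<in> S. \<Gamma> v \<in> N} \<Gamma>"
    using *(1-3) g(3) by (auto simp: network_joins_def network_def graph_tree_def)
  from shortest_networkI[OF assms(1) this *(4)] show ?thesis
    using *(2,5) unfolding shortest_nondegenerate_tree_def nondegenerate_network_def by blast
qed

lemma distances_nonzero_if_shortest_nondegenerate:
  assumes "shortest_network M d N V E B \<Gamma>" "nondegenerate_network d E \<Gamma>"
    and "x \<in> N" "y \<in> N" "x \<noteq> y"
  shows "d x y \<noteq> 0"
proof
  assume xy: "d x y = 0"
  note g = shortest_networkD[OF assms(1)]
  obtain u v where uv: "u \<in> V" "v \<in> V" "\<Gamma> u = x" "\<Gamma> v = y" using g(4) assms(3,4) by blast
  have "{u, v} \<notin> E"
    using assms(2) xy uv unfolding nondegenerate_network_def by force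
  moreover have "u \<noteq> v" using uv assms(5) by blast
  ultimately obtain e where e: "e \<in> E" "fin_graph V (insert {u, v} (E - {e}))"
    "graph_connected V (insert {u, v} (E - {e}))"
    using exchange_edge[OF g(1,2) uv(1,2)] by blast
  have "network_joins M N V (insert {u, v} (E - {e})) B \<Gamma>"
    using e g by (simp add: network_joins_def network_def)
  from smt_le[OF this] have "smt M d N \<le> network_length d (insert {u, v} (E - {e})) \<Gamma>" .
  also have "\<dots> \<le> network_length d (E - {e}) \<Gamma>"
    using network_length_insert_le[OF fin_graph_mono[OF g(1)], of "E - {e}" u v \<Gamma>] uv xy by auto
  also have "\<dots> < network_length d E \<Gamma>"
  proof -
    have "0 < edge_length d \<Gamma> e"
      using assms(2) e(1) edge_length_nonneg[OF g(1) e(1), of \<Gamma>]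
      by (auto simp: nondegenerate_network_def less_le)
    then show ?thesis
      using sum.remove[OF fin_graph_finite_edges[OF g(1)] e(1), of "edge_length d \<Gamma>"]
      by (simp add: network_length_def)
  qed
  finally show False using assms(1) by (simp add: shortest_network_def)
qed

end

theorem theorem2p1:
  fixes M :: "'a set" and \<rho> :: "'a \<Rightarrow> 'a \<Rightarrow> real"
    and X N :: "'x set" and d :: "'x \<Rightarrow> 'x \<Rightarrow> real"
  shows
    "(finite M \<and> Pseudometric_space M \<rho> \<longrightarrow>
        (2 \<le> card M \<longrightarrow>
           (\<exists>V E \<omega>. minimal_filling M \<rho> V E \<omega> \<and> binary_tree V E (Inl ` M))) \<and>
        (Metric_space M \<rho> \<longrightarrow>
           (\<exists>V E \<omega>. minimal_filling M \<rho> V E \<omega> \<and> graph_tree V E \<and> nondegenerate_weight E \<omega>)) \<and>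
        ((\<exists>V E \<omega>. minimal_filling M \<rho> V E \<omega> \<and> nondegenerate_weight E \<omega>) \<longrightarrow>
           Metric_space M \<rho>)) \<and>
     (Pseudometric_space X d \<and> finite N \<and> N \<subseteq> X \<longrightarrow>
        ((\<exists>V E B \<Gamma>. shortest_network X d N V E B \<Gamma>) \<longrightarrow>
           (N \<noteq> {} \<longrightarrow> (\<exists>V E B \<Gamma>. shortest_binary_tree X d N V E B \<Gamma>)) \<and>
           ((\<forall>x\<in>N. \<forall>y\<in>N. x \<noteq> y \<longrightarrow> d x y \<noteq> 0) \<longrightarrow>
              (\<exists>V E B \<Gamma>. shortest_nondegenerate_tree X d N V E B \<Gamma>))) \<and>
        ((\<exists>V E B \<Gamma>. shortest_nondegenerate_tree X d N V E B \<Gamma>) \<longrightarrow>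
           (\<forall>x\<in>N. \<forall>y\<in>N. x \<noteq> y \<longrightarrow> d x y \<noteq> 0)))"
proof (intro conjI impI)
  assume "finite M \<and> Pseudometric_space M \<rho>"
  then have fin: "finite M" and ps: "Pseudometric_space M \<rho>" by auto
  show binary: "\<exists>V E \<omega>. minimal_filling M \<rho> V E \<omega> \<and> binary_tree V E (Inl ` M)" if "2 \<le> card M"
    by (rule minimal_binary_tree_filling[OF ps fin that])
  show "\<exists>V E \<omega>. minimal_filling M \<rho> V E \<omega> \<and> graph_tree V E \<and> nondegenerate_weight E \<omega>"
    if metric: "Metric_space M \<rho>"
  proof -
    obtain V E \<omega> where min: "minimal_filling M \<rho> V E \<omega>"
      using binary minimal_filling_small[OF ps fin] by (cases "2 \<le> card M") auto
    then have "filling M \<rho> V E \<omega>" by (simp add: minimal_filling_def)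
    then obtain S F \<omega>' where *: "filling M \<rho> S F \<omega>'" "graph_tree S F" "nondegenerate_weight F \<omega>'"
      "sum \<omega>' F \<le> sum \<omega> E"
      using nondegenerate_tree_filling[OF _ metric] by blast
    then have "minimal_filling M \<rho> S F \<omega>'"
      using min mf_le[OF *(1)] by (simp add: minimal_filling_def)
    with *(2,3) show ?thesis by blast
  qed
  show "Metric_space M \<rho>" if "\<exists>V E \<omega>. minimal_filling M \<rho> V E \<omega> \<and> nondegenerate_weight E \<omega>"
    using that metric_if_nondegenerate_minimal_filling[OF ps] by blast
next
  assume "Pseudometric_space X d \<and> finite N \<and> N \<subseteq> X"
  then have fin: "finite N" and ps: "Pseudometric_space X d" by auto
  interpret Pseudometric_space X d by (rule ps)
  show "\<exists>V E B \<Gamma>. shortest_binary_tree X d N V E B \<Gamma>"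
    if "\<exists>V E B \<Gamma>. shortest_network X d N V E B \<Gamma>" "N \<noteq> {}"
    using that fin shortest_binary_tree_exists by blast
  show "\<exists>V E B \<Gamma>. shortest_nondegenerate_tree X d N V E B \<Gamma>"
    if "\<exists>V E B \<Gamma>. shortest_network X d N V E B \<Gamma>" "\<forall>x\<in>N. \<forall>y\<in>N. x \<noteq> y \<longrightarrow> d x y \<noteq> 0"
    using that shortest_nondegenerate_tree_exists by blast
  show "\<forall>x\<in>N. \<forall>y\<in>N. x \<noteq> y \<longrightarrow> d x y \<noteq> 0"
    if "\<exists>V E B \<Gamma>. shortest_nondegenerate_tree X d N V E B \<Gamma>"
    using that distances_nonzero_if_shortest_nondegenerate
    unfolding shortest_nondegenerate_tree_def by blast
qed

end
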